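(* Let $A$ and $B$ be effect algebras with $0\neq 1$. For any $n>0$, $\mathrm{HC}^n(A+B)\cong\mathrm{HC}^n(A)\oplus\mathrm{HC}^n(B)$.
   Context: An effect algebra is a set $A$ with a partial binary operation $\boxplus$, a unary operation $(-)^\bot$ and elements $0,1\in A$ such that: if $a\boxplus b$ is defined then so is $b\boxplus a$ and they are equal; if $a\boxplus b$ and $(a\boxplus b)\boxplus c$ are defined then so are $b\boxplus c$ and $a\boxplus(b\boxplus c)$, and $(a\boxplus b)\boxplus c=a\boxplus(b\boxplus c)$; $0\boxplus a$ is always defined and equals $a$; for each $a$, $a^\bot$ is the unique element with $a\boxplus a^\bot=1$; if $a\boxplus 1$ is defined then $a=0$. The coproduct $A+B$ is the quotient of the disjoint union of $A$ and $B$ identifying $0_A$ with $0_B$ and $1_A$ with $1_B$; sums of two elements coming from $A$ (resp. from $B$) are defined iff they are defined in $A$ (resp. $B$) and are computed there; the sum of $a\in A\setminus\{0,1\}$ and $b\in B\setminus\{0,1\}$ is never defined; orthocomplements are those of $A$ and $B$. Cyclic cohomology (coefficients in $\mathbb{R}$): for $n\ge 0$ let $T_n(A)=\{(a_0,\dots,a_n)\in A^{n+1}\mid a_0\boxplus\cdots\boxplus a_n \text{ is defined and equals } 1\}$. Let $C^n(A)=\mathbb{R}^{T_n(A)}$ with coboundary $\delta^n:C^n(A)\to C^{n+1}(A)$, $$\delta^n(\alpha)(a_0,\dots,a_{n+1})=\sum_{i=0}^{n}(-1)^i\alpha(a_0,\dots,a_i\boxplus a_{i+1},\dots,a_{n+1})+(-1)^{n+1}\alpha(a_{n+1}\boxplus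 a_0,a_1,\dots,a_n).$$ Let $C^n_\lambda(A)\subseteq C^n(A)$ be the subspace of $\alpha$ with $\alpha(a_0,\dots,a_n)=(-1)^n\alpha(a_n,a_0,\dots,a_{n-1})$ for all tests; these form a subcomplex. The cyclic cohomology $\mathrm{HC}^n(A)$ is the $n$-th cohomology of $C_\lambda^\bullet(A)$. *)

theory Defs
  imports "Jordan_Normal_Form.VS_Connect" "HOL-Algebra.AbelCoset"
begin

section \<open>Effect algebras\<close>

text \<open>The partial sum is option-valued; \<^term>\<open>None\<close> means \<open>undefined\<close>.
  Its values at arguments outside the carrier are irrelevant.\<close>

record 'a effect_alg = "'a partial_object" +
  psum :: "'a \<Rightarrow> 'a \<Rightarrow> 'a option"
  ortho :: "'a \<Rightarrow> 'a"
  ezero :: 'a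
  eone :: 'a

locale effect_algebra =
  fixes A :: "'a effect_alg"
  assumes psum_closed: "\<lbrakk>a \<in> carrier A; b \<in> carrier A; psum A a b = Some c\<rbrakk> \<Longrightarrow> c \<in> carrier A"
    and ortho_closed: "a \<in> carrier A \<Longrightarrow> ortho A a \<in> carrier A"
    and ezero_closed: "ezero A \<in> carrier A"
    and eone_closed: "eone A \<in> carrier A"
    and psum_comm: "\<lbrakk>a \<in> carrier A; b \<in> carrier A; psum A a b = Some c\<rbrakk> \<Longrightarrow> psum A b a = Some c"
    and psum_assoc: "\<lbrakk>a \<in> carrier A; b \<in> carrier A; c \<in> carrier A;
        psum A a b = Some d; psum A d c = Some e\<rbrakk>
      \<Longrightarrow> \<exists>f. psum A b c = Some f \<and> psum A a f = Some e"
    and psum_ezero: "a \<in> carrier A \<Longrightarrow> psum A (ezero A) a = Some a"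
    and psum_ortho: "a \<in> carrier A \<Longrightarrow> psum A a (ortho A a) = Some (eone A)"
    and ortho_unique: "\<lbrakk>a \<in> carrier A; b \<in> carrier A; psum A a b = Some (eone A)\<rbrakk> \<Longrightarrow> b = ortho A a"
    and psum_eone: "\<lbrakk>a \<in> carrier A; psum A a (eone A) \<noteq> None\<rbrakk> \<Longrightarrow> a = ezero A"


section \<open>Coproducts\<close>

text \<open>The equivalence relation on the disjoint union generated by identifying the zeros and
  the ones.\<close>

definition coprod_rel :: "'a effect_alg \<Rightarrow> 'b effect_alg \<Rightarrow> (('a + 'b) \<times> ('a + 'b)) set" where
  "coprod_rel A B =
    (let r = {(Inl (ezero A), Inr (ezero B)), (Inl (eone A), Inr (eone B))}
     in Id_on (Sum_Type.Plus (carrier A) (carrier B)) \<union> (r \<union> r\<inverse>)\<^sup>+)"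

definition coprod_inl :: "'a effect_alg \<Rightarrow> 'b effect_alg \<Rightarrow> 'a \<Rightarrow> ('a + 'b) set" where
  "coprod_inl A B a = coprod_rel A B `` {Inl a}"

definition coprod_inr :: "'a effect_alg \<Rightarrow> 'b effect_alg \<Rightarrow> 'b \<Rightarrow> ('a + 'b) set" where
  "coprod_inr A B b = coprod_rel A B `` {Inr b}"

definition coprod_psum_rel ::
  "'a effect_alg \<Rightarrow> 'b effect_alg \<Rightarrow> ('a + 'b) set \<Rightarrow> ('a + 'b) set \<Rightarrow> ('a + 'b) set \<Rightarrow> bool" where
  "coprod_psum_rel A B X Y Z \<longleftrightarrow>
    (\<exists>a\<in>carrier A. \<exists>a'\<in>carrier A. \<exists>c. X = coprod_inl A B a \<and> Y = coprod_inl A B a' \<and>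
       psum A a a' = Some c \<and> Z = coprod_inl A B c) \<or>
    (\<exists>b\<in>carrier B. \<exists>b'\<in>carrier B. \<exists>c. X = coprod_inr A B b \<and> Y = coprod_inr A B b' \<and>
       psum B b b' = Some c \<and> Z = coprod_inr A B c)"

definition coproduct :: "'a effect_alg \<Rightarrow> 'b effect_alg \<Rightarrow> ('a + 'b) set effect_alg" where
  "coproduct A B =
    \<lparr> carrier = Sum_Type.Plus (carrier A) (carrier B) // coprod_rel A B,
      psum = (\<lambda>X Y. if \<exists>Z. coprod_psum_rel A B X Y Z
                    then Some (THE Z. coprod_psum_rel A B X Y Z) else None),
      ortho = (\<lambda>X. THE Z. (\<exists>a\<in>carrier A. X = coprod_inl A B a \<and> Z = coprod_inl A B (ortho A a)) \<or>
                          (\<exists>b\<in>carrier B. X = coprod_inr A B b \<and> Z = coprod_inr A B (ortho B b))),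
      ezero = coprod_inl A B (ezero A),
      eone = coprod_inl A B (eone A) \<rparr>"

lemma coprod_rel_eq:
  assumes "effect_algebra A" "ezero A \<noteq> eone A" "effect_algebra B" "ezero B \<noteq> eone B"
  shows "coprod_rel A B = Id_on (Sum_Type.Plus (carrier A) (carrier B)) \<union>
    {(Inl (ezero A), Inr (ezero B)), (Inr (ezero B), Inl (ezero A)),
     (Inl (eone A), Inr (eone B)), (Inr (eone B), Inl (eone A))}"
    (is "_ = ?D \<union> ?s")
proof -
  have mem: "ezero A \<in> carrier A" "eone A \<in> carrier A" "ezero B \<in> carrier B" "eone B \<in> carrier B"
    using assms(1,3) by (auto simp: effect_algebra_def)
  have "(x, y) \<in> ?s\<^sup>+ \<Longrightarrow> (x, y) \<in> ?D \<union> ?s" for x y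
    by (induction rule: trancl_induct) (use assms(2,4) mem in auto)
  moreover have "{(Inl (ezero A), Inr (ezero B)), (Inl (eone A), Inr (eone B))} \<union>
     {(Inl (ezero A), Inr (ezero B)), (Inl (eone A), Inr (eone B))}\<inverse> = ?s" by auto
  ultimately show ?thesis unfolding coprod_rel_def Let_def by auto
qed

lemma coproduct_effect_algebra:
  assumes A: "effect_algebra A" "ezero A \<noteq> eone A" and B: "effect_algebra B" "ezero B \<noteq> eone B"
  shows "effect_algebra (coproduct A B)"
    and "ezero (coproduct A B) \<noteq> eone (coproduct A B)"
proof -
  let ?l = "coprod_inl A B" and ?r = "coprod_inr A B" and ?R = "coprod_psum_rel A B"
  interpret A: effect_algebra A by fact
  interpret B: effect_algebra B by fact
  note mem = A.ezero_closed A.eone_closed B.ezero_closed B.eone_closed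
  note re = coprod_rel_eq[OF A B]
  have l: "?l a = (if a = ezero A then {Inl a, Inr (ezero B)} else
      if a = eone A then {Inl a, Inr (eone B)} else {Inl a})" if "a \<in> carrier A" for a
    unfolding coprod_inl_def re using that A(2) B(2) by auto
  have r: "?r b = (if b = ezero B then {Inl (ezero A), Inr b} else
      if b = eone B then {Inl (eone A), Inr b} else {Inr b})" if "b \<in> carrier B" for b
    unfolding coprod_inr_def re using that A(2) B(2) by auto
  have ll: "?l a = ?l a' \<longleftrightarrow> a = a'" if "a \<in> carrier A" "a' \<in> carrier A" for a a'
    using that by (simp add: l) (auto split: if_splits)
  have rr: "?r b = ?r b' \<longleftrightarrow> b = b'" if "b \<in> carrier B" "b' \<in> carrier B" for b b'
    using that by (simp add: r) (auto split: if_splits)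
  have lr: "?l a = ?r b \<longleftrightarrow> a = ezero A \<and> b = ezero B \<or> a = eone A \<and> b = eone B"
    if "a \<in> carrier A" "b \<in> carrier B" for a b
    using that A(2) B(2) by (simp add: l r) (auto split: if_splits)
  have car: "carrier (coproduct A B) = ?l ` carrier A \<union> ?r ` carrier B"
    by (auto simp: coproduct_def quotient_def coprod_inl_def coprod_inr_def)
  have A01: "psum A (eone A) (eone A) = None"
    using A.psum_eone[OF A.eone_closed] A(2) by metis
  have B01: "psum B (eone B) (eone B) = None"
    using B.psum_eone[OF B.eone_closed] B(2) by metis
  have A0: "psum A a (ezero A) = Some a" if "a \<in> carrier A" for a
    using A.psum_comm[OF A.ezero_closed that A.psum_ezero[OF that]] .
  have B0: "psum B a (ezero B) = Some a" if "a \<in> carrier B" for a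
    using B.psum_comm[OF B.ezero_closed that B.psum_ezero[OF that]] .
  have z: "?r (ezero B) = ?l (ezero A)" "?r (eone B) = ?l (eone A)"
    using lr[OF mem(1,3)] lr[OF mem(2,4)] by auto
  have Rll: "?R (?l a) (?l a') Z \<longleftrightarrow> (\<exists>c. psum A a a' = Some c \<and> Z = ?l c)"
    if "a \<in> carrier A" "a' \<in> carrier A" for a a' Z
    using that mem A(2) B(2) A01 B01 unfolding coprod_psum_rel_def
    by (auto simp: ll lr z A0 B0 A.psum_ezero B.psum_ezero)
  have Rrr: "?R (?r b) (?r b') Z \<longleftrightarrow> (\<exists>c. psum B b b' = Some c \<and> Z = ?r c)"
    if "b \<in> carrier B" "b' \<in> carrier B" for b b' Z
    using that mem A(2) B(2) A01 B01 unfolding coprod_psum_rel_def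
    by (auto simp: rr lr eq_commute[of "?r _" "?l _"] z[symmetric] A0 B0 A.psum_ezero B.psum_ezero)
  have uniq: "Z = Z'" if "?R X Y Z" "?R X Y Z'" for X Y Z Z'
  proof -
    from that(1) consider (1) a a' where "a \<in> carrier A" "a' \<in> carrier A" "X = ?l a" "Y = ?l a'"
      | (2) b b' where "b \<in> carrier B" "b' \<in> carrier B" "X = ?r b" "Y = ?r b'"
      unfolding coprod_psum_rel_def by blast
    then show ?thesis using that by cases (auto simp: Rll Rrr)
  qed
  have ps: "psum (coproduct A B) X Y = Some Z \<longleftrightarrow> ?R X Y Z" for X Y Z
  proof (cases "\<exists>Z. ?R X Y Z")
    case True
    then obtain W where W: "?R X Y W" ..
    have "(THE Z. ?R X Y Z) = W" by (rule the_equality, rule W, rule uniq[OF _ W])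
    then have "psum (coproduct A B) X Y = Some W" using True by (simp add: coproduct_def)
    then show ?thesis by (metis W uniq option.inject)
  qed (auto simp: coproduct_def)
  have Az: "ortho A (ezero A) = eone A" "ortho A (eone A) = ezero A"
    using A.ortho_unique A.psum_ezero A0 mem by metis+
  have Bz: "ortho B (ezero B) = eone B" "ortho B (eone B) = ezero B"
    using B.ortho_unique B.psum_ezero B0 mem by metis+
  have e0: "ezero (coproduct A B) = ?l (ezero A)" "?r (ezero B) = ?l (ezero A)"
    using lr[OF mem(1,3)] by (auto simp: coproduct_def)
  have e1: "eone (coproduct A B) = ?l (eone A)" "?r (eone B) = ?l (eone A)"
    using lr[OF mem(2,4)] by (auto simp: coproduct_def)
  have ol: "ortho (coproduct A B) (?l a) = ?l (ortho A a)" if "a \<in> carrier A" for a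
    unfolding coproduct_def effect_alg.simps
    by (rule the_equality) (use that mem Az Bz e0 e1 in \<open>auto simp: ll lr\<close>)
  have or: "ortho (coproduct A B) (?r a) = ?r (ortho B a)" if "a \<in> carrier B" for a
    unfolding coproduct_def effect_alg.simps
    by (rule the_equality) (use that mem Az Bz in \<open>auto simp: rr lr eq_commute[of "?r _" "?l _"] z[symmetric]\<close>)
  show "ezero (coproduct A B) \<noteq> eone (coproduct A B)"
    using ll[OF mem(1,2)] A(2) e0 e1 by simp
  show "effect_algebra (coproduct A B)"
  proof
    fix X Y Z
    assume "psum (coproduct A B) X Y = Some Z"
    then show "Z \<in> carrier (coproduct A B)" "psum (coproduct A B) Y X = Some Z"
      unfolding ps car using A.psum_comm B.psum_comm A.psum_closed B.psum_closed
      unfolding coprod_psum_rel_def by blast+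
  next
    fix X assume "X \<in> carrier (coproduct A B)"
    then consider (1) a where "a \<in> carrier A" "X = ?l a" | (2) b where "b \<in> carrier B" "X = ?r b"
      unfolding car by blast
    note cs = this
    show "ortho (coproduct A B) X \<in> carrier (coproduct A B)"
      using cs by cases (auto simp: ol or car A.ortho_closed B.ortho_closed)
    show "psum (coproduct A B) (ezero (coproduct A B)) X = Some X"
      using cs
    proof cases
      case 1 then show ?thesis unfolding ps e0 by (simp add: Rll mem A.psum_ezero)
    next
      case 2 then show ?thesis unfolding ps e0(1) e0(2)[symmetric] by (simp add: Rrr mem B.psum_ezero)
    qed
    show "psum (coproduct A B) X (ortho (coproduct A B) X) = Some (eone (coproduct A B))"
      using cs
    proof cases
      case 1 then show ?thesis unfolding ps e1 by (simp add: Rll ol mem A.ortho_closed A.psum_ortho)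
    next
      case 2 then show ?thesis unfolding ps e1(1) e1(2)[symmetric]
        by (simp add: Rrr or mem B.ortho_closed B.psum_ortho)
    qed
    { assume "psum (coproduct A B) X (eone (coproduct A B)) \<noteq> None"
      then obtain Z where Z: "?R X (eone (coproduct A B)) Z" by (auto simp: ps)
      show "X = ezero (coproduct A B)" using cs
      proof cases
        case 1 then show ?thesis using Z A.psum_eone[of a] by (simp add: e0 e1 Rll mem) auto
      next
        case 2 then show ?thesis using Z B.psum_eone[of b] 
          by (simp add: e0(1) e1(1) e0(2)[symmetric] e1(2)[symmetric] Rrr mem) auto
      qed }
    { fix Y assume "psum (coproduct A B) X Y = Some (eone (coproduct A B))"
      then have "?R X Y (?l (eone A))" by (simp add: ps e1)
      then show "Y = ortho (coproduct A B) X"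
      proof (subst (asm) coprod_psum_rel_def, elim disjE bexE exE conjE, goal_cases)
        case (1 a a' c)
        have "?l c = ?l (eone A)" using 1 by simp
        then have "c = eone A" using ll[of c "eone A"] A.psum_closed[of a a' c] mem 1 by blast
        then have "a' = ortho A a" using 1(2,3) \<open>psum A a a' = Some c\<close> A.ortho_unique[of a a'] by simp
        then show ?case using \<open>X = ?l a\<close> \<open>Y = ?l a'\<close> 1(2) ol[of a] by simp
      next
        case (2 b b' c)
        have "?r c = ?r (eone B)" using 2 e1(2) by simp
        then have "c = eone B" using rr[of c "eone B"] B.psum_closed[of b b' c] mem 2 by blast
        then have "b' = ortho B b" using 2(2,3) \<open>psum B b b' = Some c\<close> B.ortho_unique[of b b'] by simp
        then show ?case using \<open>X = ?r b\<close> \<open>Y = ?r b'\<close> 2(2) or[of b] by simp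
      qed }
  next
    fix X Y W D E
    assume W: "W \<in> carrier (coproduct A B)"
      and XY: "psum (coproduct A B) X Y = Some D" and DW: "psum (coproduct A B) D W = Some E"
    have sideA: "psum A a a' = Some d \<Longrightarrow> psum A d w = Some e \<Longrightarrow> a \<in> carrier A \<Longrightarrow> a' \<in> carrier A \<Longrightarrow> w \<in> carrier A \<Longrightarrow>
       \<exists>F. ?R (?l a') (?l w) F \<and> ?R (?l a) F (?l e)" for a a' d w e
      using A.psum_assoc[of a a' w d e] A.psum_closed[of a' w] by (auto simp: Rll)
    have sideB: "psum B a a' = Some d \<Longrightarrow> psum B d w = Some e \<Longrightarrow> a \<in> carrier B \<Longrightarrow> a' \<in> carrier B \<Longrightarrow> w \<in> carrier B \<Longrightarrow>
       \<exists>F. ?R (?r a') (?r w) F \<and> ?R (?r a) F (?r e)" for a a' d w e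
      using B.psum_assoc[of a a' w d e] B.psum_closed[of a' w] by (auto simp: Rrr)
    have nA: "a = ezero A \<and> a' = ezero A" 
      if "psum A a a' = Some (ezero A)" "a \<in> carrier A" "a' \<in> carrier A" for a a'
      using A.psum_assoc[OF that(2,3) mem(2) that(1) A.psum_ezero[OF mem(2)]] A.psum_eone[OF that(3)]
        that A0 by auto
    have nB: "a = ezero B \<and> a' = ezero B" 
      if "psum B a a' = Some (ezero B)" "a \<in> carrier B" "a' \<in> carrier B" for a a'
      using B.psum_assoc[OF that(2,3) mem(4) that(1) B.psum_ezero[OF mem(4)]] B.psum_eone[OF that(3)]
        that B0 by auto
    have "\<exists>F. ?R Y W F \<and> ?R X F E"
      using XY[unfolded ps]
    proof (subst (asm) coprod_psum_rel_def, elim disjE bexE exE conjE, goal_cases)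
      case (1 a a' d)
      have d: "d \<in> carrier A" using A.psum_closed 1 by blast
      have "(\<exists>w\<in>carrier A. W = ?l w) \<or> d = ezero A"
        using DW[unfolded ps]
      proof (subst (asm) coprod_psum_rel_def, elim disjE bexE exE conjE, goal_cases)
        case (2 b w e)
        consider "d = ezero A" | "b = eone B" using 2 1 d lr[of d b] by auto
        then show ?case
        proof cases
          case 2
          then have "w = ezero B" using \<open>psum B b w = Some e\<close> \<open>w \<in> carrier B\<close> \<open>b \<in> carrier B\<close>
            B.psum_comm[of b w e] B.psum_eone[of w] by auto
          then show ?thesis using e0 mem \<open>W = ?r w\<close> by auto
        qed auto
      qed auto
      then consider (l) w where "w \<in> carrier A" "W = ?l w" | (0) w where "d = ezero A" "w \<in> carrier B" "W = ?r w"
        using W unfolding car by auto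
      then show ?case
      proof cases
        case l
        then obtain e where "psum A d w = Some e" "E = ?l e" using DW[unfolded ps] 1 d by (auto simp: Rll)
        then show ?thesis using sideA[of a a' d w e] 1 l by auto
      next
        case 0
        then have z: "X = ?r (ezero B)" "Y = ?r (ezero B)" "D = ?r (ezero B)" 
          using nA[of a a'] 1 e0 by auto
        then have "E = ?r w" using DW[unfolded ps] 0 mem by (auto simp: Rrr B.psum_ezero)
        then show ?thesis using z 0 mem by (auto simp: Rrr B.psum_ezero)
      qed
    next
      case (2 a a' d)
      have d: "d \<in> carrier B" using B.psum_closed 2 by blast
      have "(\<exists>w\<in>carrier B. W = ?r w) \<or> d = ezero B"
        using DW[unfolded ps]
      proof (subst (asm) coprod_psum_rel_def, elim disjE bexE exE conjE, goal_cases)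
        case (1 b w e)
        consider "d = ezero B" | "b = eone A" using 1 2 d lr[of b d] by auto
        then show ?case
        proof cases
          case 2
          then have "w = ezero A" using \<open>psum A b w = Some e\<close> \<open>w \<in> carrier A\<close> \<open>b \<in> carrier A\<close>
            A.psum_comm[of b w e] A.psum_eone[of w] by auto
          then have "W = ?r (ezero B)" using e0 \<open>W = ?l w\<close> by auto
          then show ?thesis using mem by blast
        qed auto
      qed auto
      then consider (l) w where "w \<in> carrier B" "W = ?r w" | (0) w where "d = ezero B" "w \<in> carrier A" "W = ?l w"
        using W unfolding car by auto
      then show ?case
      proof cases
        case l
        then obtain e where "psum B d w = Some e" "E = ?r e" using DW[unfolded ps] 2 d by (auto simp: Rrr)
        then show ?thesis using sideB[of a a' d w e] 2 l by auto
      next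
        case 0
        then have z: "X = ?l (ezero A)" "Y = ?l (ezero A)" "D = ?l (ezero A)" 
          using nB[of a a'] 2 e0 by auto
        then have "E = ?l w" using DW[unfolded ps] 0 mem by (auto simp: Rll A.psum_ezero)
        then show ?thesis using z 0 mem by (auto simp: Rll A.psum_ezero)
      qed
    qed
    then show "\<exists>f. psum (coproduct A B) Y W = Some f \<and> psum (coproduct A B) X f = Some E"
      by (auto simp: ps)
  qed (use e0 e1 car mem in auto)
qed


section \<open>Quotient modules\<close>

text \<open>The ring operations \<^const>\<open>mult\<close> and \<^const>\<open>one\<close> of a module record
  carry no meaning. Scaling a coset takes all of \<open>N + r x\<close> rather than the set of the
  \<open>r x\<close> so that scaling by zero gives the coset \<open>N\<close>.\<close>

definition quotient_module :: "('r, 'm, 'c) module_scheme \<Rightarrow> 'm set \<Rightarrow> ('r, 'm set) module" where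
  "quotient_module M N =
    \<lparr> carrier = a_rcosets\<^bsub>M\<^esub> N,
      mult = (\<lambda>X Y. N),
      one = N,
      zero = N,
      add = (\<lambda>X Y. X <+>\<^bsub>M\<^esub> Y),
      smult = (\<lambda>r X. \<Union>x\<in>X. N +>\<^bsub>M\<^esub> (r \<odot>\<^bsub>M\<^esub> x)) \<rparr>"

lemma quotient_module_is_module:
  assumes "module R M" "submodule R N M"
  shows "module R (quotient_module M N)"
proof -
  interpret M: Module.module R M by fact
  interpret S: LinearCombinations.submodule R N M by fact
  have sub: "additive_subgroup N M"
  proof (unfold additive_subgroup_def, rule group.subgroupI[OF M.a_group])
    show "N \<subseteq> carrier (add_monoid M)" using S.subset by auto
    show "N \<noteq> {}" using S.zero_closed by blast
    show "inv\<^bsub>add_monoid M\<^esub> a \<in> N" if "a \<in> N" for a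
      using S.smult_closed[of "\<ominus>\<^bsub>R\<^esub> \<one>\<^bsub>R\<^esub>" a] that
        M.smult_l_minus[of "\<one>\<^bsub>R\<^esub>" a] subsetD[OF S.subset that] by (auto simp: a_inv_def[symmetric])
  qed auto
  interpret N: abelian_subgroup N M
    by (rule abelian_subgroupI3[OF sub M.abelian_group_axioms])
  have sm: "(\<Union>y\<in>N +>\<^bsub>M\<^esub> x. N +>\<^bsub>M\<^esub> (r \<odot>\<^bsub>M\<^esub> y)) = N +>\<^bsub>M\<^esub> (r \<odot>\<^bsub>M\<^esub> x)"
    if "r \<in> carrier R" "x \<in> carrier M" for r x
  proof -
    have "N +>\<^bsub>M\<^esub> (r \<odot>\<^bsub>M\<^esub> y) = N +>\<^bsub>M\<^esub> (r \<odot>\<^bsub>M\<^esub> x)" if y: "y \<in> N +>\<^bsub>M\<^esub> x" for y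
    proof -
      from y obtain h where h: "h \<in> N" "y = h \<oplus>\<^bsub>M\<^esub> x" by (auto simp: a_r_coset_def')
      then have "r \<odot>\<^bsub>M\<^esub> y = r \<odot>\<^bsub>M\<^esub> h \<oplus>\<^bsub>M\<^esub> r \<odot>\<^bsub>M\<^esub> x"
        using \<open>r \<in> carrier R\<close> \<open>x \<in> carrier M\<close> S.subset by (auto simp: M.smult_r_distr)
      then have "r \<odot>\<^bsub>M\<^esub> y \<in> N +>\<^bsub>M\<^esub> (r \<odot>\<^bsub>M\<^esub> x)"
        using h \<open>r \<in> carrier R\<close> by (auto simp: a_r_coset_def')
      then show ?thesis using N.a_repr_independence'[of _ "r \<odot>\<^bsub>M\<^esub> x"] \<open>r \<in> carrier R\<close> \<open>x \<in> carrier M\<close> by (simp add: M.smult_closed)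
    qed
    moreover have "x \<in> N +>\<^bsub>M\<^esub> x" using \<open>x \<in> carrier M\<close> by (rule N.a_rcos_self)
    ultimately show ?thesis by blast
  qed
  note [simp] = N.a_rcos_sum sm
  have N0: "N +>\<^bsub>M\<^esub> \<zero>\<^bsub>M\<^esub> = N" using M.a_coset_join2[OF M.zero_closed N.a_subgroup] S.zero_closed by simp
  have car: "carrier (quotient_module M N) = (\<lambda>x. N +>\<^bsub>M\<^esub> x) ` carrier M"
    by (auto simp: quotient_module_def A_RCOSETS_def')
  have ops: "\<zero>\<^bsub>quotient_module M N\<^esub> = N +>\<^bsub>M\<^esub> \<zero>\<^bsub>M\<^esub>"
    "x \<in> carrier M \<Longrightarrow> y \<in> carrier M \<Longrightarrow>
      (N +>\<^bsub>M\<^esub> x) \<oplus>\<^bsub>quotient_module M N\<^esub> (N +>\<^bsub>M\<^esub> y) = N +>\<^bsub>M\<^esub> (x \<oplus>\<^bsub>M\<^esub> y)"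
    "r \<in> carrier R \<Longrightarrow> x \<in> carrier M \<Longrightarrow>
      r \<odot>\<^bsub>quotient_module M N\<^esub> (N +>\<^bsub>M\<^esub> x) = N +>\<^bsub>M\<^esub> (r \<odot>\<^bsub>M\<^esub> x)" for r x y
    by (simp_all add: quotient_module_def N0)
  show ?thesis
  proof (rule moduleI)
    show "cring R" by (rule M.R.is_cring)
    show "abelian_group (quotient_module M N)"
    proof (rule abelian_groupI, goal_cases)
      case (6 X)
      then obtain x where x: "x \<in> carrier M" "X = N +>\<^bsub>M\<^esub> x" by (auto simp: car)
      then show ?case
        by (intro bexI[of _ "N +>\<^bsub>M\<^esub> (\<ominus>\<^bsub>M\<^esub> x)"]) (auto simp: car ops M.l_neg)
    qed (auto simp: car ops M.a_ac)
  qed (auto simp: car ops M.smult_l_distr M.smult_r_distr M.smult_assoc1)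
qed


section \<open>Cyclic cohomology\<close>

fun psum_list :: "'a effect_alg \<Rightarrow> 'a list \<Rightarrow> 'a option" where
  "psum_list A [] = Some (ezero A)"
| "psum_list A (a # as) = foldl (\<lambda>s b. Option.bind s (\<lambda>x. psum A x b)) (Some a) as"

text \<open>The tuple \<open>(a\<^sub>0, \<dots>, a\<^sub>n)\<close> is a list of length \<open>n + 1\<close>.\<close>

definition tests :: "'a effect_alg \<Rightarrow> nat \<Rightarrow> 'a list set" where
  "tests A n = {as. length as = Suc n \<and> set as \<subseteq> carrier A \<and> psum_list A as = Some (eone A)}"

definition merge :: "'a effect_alg \<Rightarrow> nat \<Rightarrow> 'a list \<Rightarrow> 'a list" where
  "merge A i as = take i as @ the (psum A (as ! i) (as ! Suc i)) # drop (Suc (Suc i)) as"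

definition cyclic_merge :: "'a effect_alg \<Rightarrow> 'a list \<Rightarrow> 'a list" where
  "cyclic_merge A as = the (psum A (last as) (hd as)) # butlast (tl as)"

text \<open>Cochains are extensional: \<^const>\<open>undefined\<close> outside \<^term>\<open>tests A n\<close>.\<close>

definition cochains :: "'a effect_alg \<Rightarrow> nat \<Rightarrow> (real, 'a list \<Rightarrow> real) module" where
  "cochains A n = ring.func_space class_ring (tests A n)"

definition coboundary ::
  "'a effect_alg \<Rightarrow> nat \<Rightarrow> ('a list \<Rightarrow> real) \<Rightarrow> ('a list \<Rightarrow> real)" where
  "coboundary A n \<alpha> =
    (\<lambda>as\<in>tests A (Suc n).
      (\<Sum>i\<le>n. (-1) ^ i * \<alpha> (merge A i as)) + (-1) ^ Suc n * \<alpha> (cyclic_merge A as))"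

definition cyclic_cochains :: "'a effect_alg \<Rightarrow> nat \<Rightarrow> (real, 'a list \<Rightarrow> real) module" where
  "cyclic_cochains A n = (cochains A n)
    \<lparr>carrier := {\<alpha> \<in> carrier (cochains A n).
       \<forall>as\<in>tests A n. \<alpha> as = (-1) ^ n * \<alpha> (last as # butlast as)}\<rparr>"

definition cyclic_cocycles :: "'a effect_alg \<Rightarrow> nat \<Rightarrow> ('a list \<Rightarrow> real) set" where
  "cyclic_cocycles A n =
    {\<alpha> \<in> carrier (cyclic_cochains A n). coboundary A n \<alpha> = \<zero>\<^bsub>cyclic_cochains A (Suc n)\<^esub>}"

definition cyclic_coboundaries :: "'a effect_alg \<Rightarrow> nat \<Rightarrow> ('a list \<Rightarrow> real) set" where
  "cyclic_coboundaries A n =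
    (case n of 0 \<Rightarrow> {\<zero>\<^bsub>cyclic_cochains A 0\<^esub>}
     | Suc m \<Rightarrow> coboundary A m ` carrier (cyclic_cochains A m))"

definition HC :: "'a effect_alg \<Rightarrow> nat \<Rightarrow> (real, ('a list \<Rightarrow> real) set) module" where
  "HC A n = quotient_module ((cyclic_cochains A n)\<lparr>carrier := cyclic_cocycles A n\<rparr>)
              (cyclic_coboundaries A n)"

text \<open>The locale \<^locale>\<open>linear_map\<close> includes that both sides are vector spaces over \<open>K\<close>.\<close>

definition vs_iso :: "('k, 'c) ring_scheme \<Rightarrow> ('k, 'v, 'd) module_scheme \<Rightarrow>
    ('k, 'w, 'e) module_scheme \<Rightarrow> bool" where
  "vs_iso K V W \<longleftrightarrow> (\<exists>f. linear_map K V W f \<and> bij_betw f (carrier V) (carrier W))"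

end

(* A test on A + B is a test on A or a test on B, and the common tests are the tuples
   with one entry 1 and all others 0. So there is an exact sequence
   0 -> C_lambda(A+B) -> C_lambda(A) + C_lambda(B) -> C_lambda({0,1}) -> 0.
   A cyclic cochain on {0,1} is determined by its value u at (1,0,...,0), and the coboundary
   sends u to u in odd degrees and to 0 in even degrees, so {0,1} has no cohomology in positive
   degrees. Concretely, cocycles on A and B can be glued after changing one of them by a
   coboundary whose value at (1,0,...,0) corrects the mismatch, and cochains witnessing that two
   restrictions are coboundaries can be glued after adding a cocycle. For those witnesses in
   degree 0, where {0,1} does have cohomology, this cocycle is the constant 1. *)
theory Submission
  imports Defs
begin

section \<open>Isomorphisms of quotient modules\<close>

text \<open>No long exact sequence is built. It suffices that a cocycle of positive degree n is a
  coboundary whenever both restrictions are, and that every pair of cocycles is reached up to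
  coboundaries. The first point glues in degree n - 1, the second in degree n; in each, the parity
  of the degree decides whether the values at (1,0,...,0) agree by themselves or have to be
  corrected. Parity enters because every face of (1,0,...,0) is again of this form, so that the
  coboundary out of degree n leaves only an alternating sum of n + 2 signs. That a test of A + B
  lies on one side is not immediate: a partial sum equal to 0 or 1 belongs to both summands, and the
  next sum may be computed on the other side. Positivity (a sum is 0 only if both terms are) and the
  axiom on a + 1 show that the list can still be read on a single side. Degree 0 is a genuine
  exception to the theorem: (1) is the only test there, and all three cohomology spaces are
  one-dimensional.\<close>

lemma submodule_imp_abelian_subgroup:
  assumes "submodule R N M"
  shows "abelian_subgroup N M"
proof -
  interpret S: LinearCombinations.submodule R N M by fact
  interpret M: Module.module R M by (rule S.module)
  have "additive_subgroup N M"
  proof (unfold additive_subgroup_def, rule group.subgroupI[OF M.a_group])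
    show "N \<subseteq> carrier (add_monoid M)" using S.subset by simp
    show "N \<noteq> {}" using S.zero_closed by blast
    show "inv\<^bsub>add_monoid M\<^esub> a \<in> N" if "a \<in> N" for a
      using S.smult_closed[of "\<ominus>\<^bsub>R\<^esub> \<one>\<^bsub>R\<^esub>" a] that
        M.smult_l_minus[of "\<one>\<^bsub>R\<^esub>" a] subsetD[OF S.subset that] by (auto simp: a_inv_def[symmetric])
  qed auto
  then show ?thesis by (rule abelian_subgroupI3[OF _ M.abelian_group_axioms])
qed

lemma carrier_quotient_module:
  "carrier (quotient_module M N) = (\<lambda>x. N +>\<^bsub>M\<^esub> x) ` carrier M"
  by (auto simp: quotient_module_def A_RCOSETS_def')

lemma add_quotient_module:
  assumes "submodule R N M" "x \<in> carrier M" "y \<in> carrier M"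
  shows "(N +>\<^bsub>M\<^esub> x) \<oplus>\<^bsub>quotient_module M N\<^esub> (N +>\<^bsub>M\<^esub> y) = N +>\<^bsub>M\<^esub> (x \<oplus>\<^bsub>M\<^esub> y)"
  using abelian_subgroup.a_rcos_sum[OF submodule_imp_abelian_subgroup] assms
  by (simp add: quotient_module_def)

text \<open>Scaling is a union over all \<open>y\<close> in the coset. Each \<open>y\<close> differs
  from \<open>x\<close> by some \<open>h\<close> in \<open>N\<close>, and scaling \<open>h\<close>
  stays in \<open>N\<close>, so all cosets in the union coincide.\<close>

lemma smult_quotient_module:
  assumes N: "submodule R N M" and r: "r \<in> carrier R" and x: "x \<in> carrier M"
  shows "r \<odot>\<^bsub>quotient_module M N\<^esub> (N +>\<^bsub>M\<^esub> x) = N +>\<^bsub>M\<^esub> (r \<odot>\<^bsub>M\<^esub> x)"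
proof -
  interpret S: LinearCombinations.submodule R N M by fact
  interpret M: Module.module R M by (rule S.module)
  interpret N: abelian_subgroup N M by (rule submodule_imp_abelian_subgroup[OF N])
  have "N +>\<^bsub>M\<^esub> (r \<odot>\<^bsub>M\<^esub> y) = N +>\<^bsub>M\<^esub> (r \<odot>\<^bsub>M\<^esub> x)" if y: "y \<in> N +>\<^bsub>M\<^esub> x" for y
  proof -
    from y obtain h where h: "h \<in> N" "y = h \<oplus>\<^bsub>M\<^esub> x" by (auto simp: a_r_coset_def')
    then have "r \<odot>\<^bsub>M\<^esub> y = r \<odot>\<^bsub>M\<^esub> h \<oplus>\<^bsub>M\<^esub> r \<odot>\<^bsub>M\<^esub> x"
      using r x S.subset by (auto simp: M.smult_r_distr)
    then have "r \<odot>\<^bsub>M\<^esub> y \<in> N +>\<^bsub>M\<^esub> (r \<odot>\<^bsub>M\<^esub> x)"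
      using h r by (auto simp: a_r_coset_def')
    then show ?thesis
      using N.a_repr_independence'[of _ "r \<odot>\<^bsub>M\<^esub> x"] r x by (simp add: M.smult_closed)
  qed
  moreover have "x \<in> N +>\<^bsub>M\<^esub> x" using x by (rule N.a_rcos_self)
  ultimately have "(\<Union>y\<in>N +>\<^bsub>M\<^esub> x. N +>\<^bsub>M\<^esub> (r \<odot>\<^bsub>M\<^esub> y)) = N +>\<^bsub>M\<^esub> (r \<odot>\<^bsub>M\<^esub> x)"
    by blast
  then show ?thesis by (simp add: quotient_module_def)
qed

lemma coset_eq_iff:
  assumes N: "submodule R N M" and "x \<in> carrier M" "y \<in> carrier M"
  shows "N +>\<^bsub>M\<^esub> x = N +>\<^bsub>M\<^esub> y \<longleftrightarrow> x \<ominus>\<^bsub>M\<^esub> y \<in> N"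
proof -
  interpret S: LinearCombinations.submodule R N M by fact
  interpret M: Module.module R M by (rule S.module)
  interpret N: abelian_subgroup N M by (rule submodule_imp_abelian_subgroup[OF N])
  show ?thesis
    using N.a_rcos_module[OF assms(3,2)] N.a_repr_independence'[OF _ assms(3), of x]
      N.a_repr_independenceD[OF assms(2), of y] unfolding M.minus_eq by blast
qed

text \<open>Applied to a difference of two elements, \<open>inj\<close> read from left to right
  makes the map on cosets well defined, and from right to left injective. \<open>surj\<close> asks
  for preimages only up to \<open>N1\<close> and \<open>N2\<close>, since a pair of cocycles need
  not glue before a correction.\<close>

lemma vs_iso_quotient_direct_sum:
  assumes K: "field K"
    and N: "submodule K N M" and N1: "submodule K N1 M1" and N2: "submodule K N2 M2"
    and f: "f \<in> LinearCombinations.module_hom K M M1" and g: "g \<in> LinearCombinations.module_hom K M M2"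
    and inj: "\<And>x. x \<in> carrier M \<Longrightarrow> x \<in> N \<longleftrightarrow> f x \<in> N1 \<and> g x \<in> N2"
    and surj: "\<And>y z. y \<in> carrier M1 \<Longrightarrow> z \<in> carrier M2 \<Longrightarrow>
      \<exists>x\<in>carrier M. \<exists>b\<in>N1. \<exists>c\<in>N2. f x = b \<oplus>\<^bsub>M1\<^esub> y \<and> g x = c \<oplus>\<^bsub>M2\<^esub> z"
  shows "vs_iso K (quotient_module M N)
    (direct_sum (quotient_module M1 N1) (quotient_module M2 N2))"
proof -
  have M: "module K M" "module K M1" "module K M2"
    using N N1 N2 by (simp_all add: LinearCombinations.submodule_def)
  interpret M: Module.module K M by fact
  interpret f: mod_hom K M M1 f using M f by (simp add: mod_hom_def mod_hom_axioms_def)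
  interpret g: mod_hom K M M2 g using M g by (simp add: mod_hom_def mod_hom_axioms_def)
  note mods = quotient_module_is_module[OF M(1) N] quotient_module_is_module[OF M(2) N1]
    quotient_module_is_module[OF M(3) N2]
  \<comment> \<open>The value at a coset is computed from an arbitrary representative;
    \<open>iff\<close> below makes the choice irrelevant.\<close>
  define F where "F = (\<lambda>X. let x = SOME x. x \<in> carrier M \<and> N +>\<^bsub>M\<^esub> x = X
    in (N1 +>\<^bsub>M1\<^esub> f x, N2 +>\<^bsub>M2\<^esub> g x))"
  have fdiff: "f (x \<ominus>\<^bsub>M\<^esub> y) = f x \<ominus>\<^bsub>M1\<^esub> f y" "g (x \<ominus>\<^bsub>M\<^esub> y) = g x \<ominus>\<^bsub>M2\<^esub> g y"
    if "x \<in> carrier M" "y \<in> carrier M" for x y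
    using that by (simp_all add: M.minus_eq f.N.M.minus_eq g.N.M.minus_eq)
  have iff: "N +>\<^bsub>M\<^esub> x = N +>\<^bsub>M\<^esub> y \<longleftrightarrow>
      N1 +>\<^bsub>M1\<^esub> f x = N1 +>\<^bsub>M1\<^esub> f y \<and> N2 +>\<^bsub>M2\<^esub> g x = N2 +>\<^bsub>M2\<^esub> g y"
    if "x \<in> carrier M" "y \<in> carrier M" for x y
    using that inj[of "x \<ominus>\<^bsub>M\<^esub> y"]
    by (simp add: coset_eq_iff[OF N] coset_eq_iff[OF N1] coset_eq_iff[OF N2] fdiff)
  have F: "F (N +>\<^bsub>M\<^esub> x) = (N1 +>\<^bsub>M1\<^esub> f x, N2 +>\<^bsub>M2\<^esub> g x)" if x: "x \<in> carrier M" for x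
  proof -
    let ?x = "SOME y. y \<in> carrier M \<and> N +>\<^bsub>M\<^esub> y = N +>\<^bsub>M\<^esub> x"
    have "?x \<in> carrier M \<and> N +>\<^bsub>M\<^esub> ?x = N +>\<^bsub>M\<^esub> x"
      by (rule someI[of _ x]) (use x in simp)
    then show ?thesis using iff[of ?x x] x unfolding F_def Let_def by blast
  qed
  have "linear_map K (quotient_module M N)
    (direct_sum (quotient_module M1 N1) (quotient_module M2 N2)) F"
    unfolding linear_map_def vectorspace_def mod_hom_def mod_hom_axioms_def
    using K mods direct_sum_is_module[OF mods(2,3)]
    by (auto simp: LinearCombinations.module_hom_def carrier_quotient_module F direct_sum_def
        add_quotient_module[OF N] add_quotient_module[OF N1] add_quotient_module[OF N2]
        smult_quotient_module[OF N] smult_quotient_module[OF N1] smult_quotient_module[OF N2])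
  moreover have "bij_betw F (carrier (quotient_module M N))
    (carrier (direct_sum (quotient_module M1 N1) (quotient_module M2 N2)))"
  proof (rule bij_betw_imageI)
    show "inj_on F (carrier (quotient_module M N))"
      unfolding carrier_quotient_module by (auto simp: inj_on_def F iff)
    have "\<exists>x\<in>carrier M. F (N +>\<^bsub>M\<^esub> x) = (N1 +>\<^bsub>M1\<^esub> y, N2 +>\<^bsub>M2\<^esub> z)"
      if y: "y \<in> carrier M1" and z: "z \<in> carrier M2" for y z
    proof -
      obtain x b c where x: "x \<in> carrier M" and b: "b \<in> N1" "f x = b \<oplus>\<^bsub>M1\<^esub> y"
        and c: "c \<in> N2" "g x = c \<oplus>\<^bsub>M2\<^esub> z"
        using surj[OF y z] by blast
      have "N1 +>\<^bsub>M1\<^esub> f x = N1 +>\<^bsub>M1\<^esub> y" "N2 +>\<^bsub>M2\<^esub> g x = N2 +>\<^bsub>M2\<^esub> z"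
        using abelian_subgroup.a_repr_independence'[OF submodule_imp_abelian_subgroup] N1 N2 y z b c
        by (metis (no_types, lifting) UN_I a_r_coset_def' singletonI)+
      then show ?thesis using x by (auto simp: F)
    qed
    then have "(\<lambda>x. N1 +>\<^bsub>M1\<^esub> x) ` carrier M1 \<times> (\<lambda>x. N2 +>\<^bsub>M2\<^esub> x) ` carrier M2
        \<subseteq> (\<lambda>x. F (N +>\<^bsub>M\<^esub> x)) ` carrier M"
      by (clarsimp simp: image_iff) metis
    moreover have "(\<lambda>x. F (N +>\<^bsub>M\<^esub> x)) ` carrier M
        \<subseteq> (\<lambda>x. N1 +>\<^bsub>M1\<^esub> x) ` carrier M1 \<times> (\<lambda>x. N2 +>\<^bsub>M2\<^esub> x) ` carrier M2"
      by (auto simp: F)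
    ultimately show "F ` carrier (quotient_module M N) =
      carrier (direct_sum (quotient_module M1 N1) (quotient_module M2 N2))"
      by (simp add: carrier_quotient_module direct_sum_def image_image)
  qed
  ultimately show ?thesis unfolding vs_iso_def by blast
qed

section \<open>Sums of lists and tests\<close>

text \<open>Restricting the sum to the carrier makes it commutative and associative on all options,
  since \<^const>\<open>psum\<close> is arbitrary outside the carrier.\<close>

definition osum :: "'a effect_alg \<Rightarrow> 'a option \<Rightarrow> 'a option \<Rightarrow> 'a option" where
  "osum A s t = (case (s, t) of
     (Some x, Some y) \<Rightarrow> if x \<in> carrier A \<and> y \<in> carrier A then psum A x y else None
   | _ \<Rightarrow> None)"

text \<open>A right fold, so that list induction peels off the first entry and leaves the sum of a
  suffix. \<open>psum_list\<close> folds from the left; \<open>psum_list_eq_lsum\<close> reconciles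
  the two.\<close>

definition lsum :: "'a effect_alg \<Rightarrow> 'a list \<Rightarrow> 'a option" where
  "lsum A as = foldr (\<lambda>a. osum A (Some a)) as (Some (ezero A))"

lemma osum_simps [simp]:
  "osum A None t = None" "osum A s None = None"
  "x \<in> carrier A \<Longrightarrow> y \<in> carrier A \<Longrightarrow> osum A (Some x) (Some y) = psum A x y"
  by (auto simp: osum_def split: option.splits)

lemma osum_SomeE:
  assumes "osum A s t = Some z"
  obtains x y where "s = Some x" "t = Some y" "x \<in> carrier A" "y \<in> carrier A" "psum A x y = Some z"
  using assms by (auto simp: osum_def split: option.splits if_splits)

lemma lsum_simps [simp]:
  "lsum A [] = Some (ezero A)" "lsum A (a # as) = osum A (Some a) (lsum A as)"
  by (simp_all add: lsum_def)

context effect_algebra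
begin

lemma osum_in_carrier: "osum A s t = Some z \<Longrightarrow> z \<in> carrier A"
  by (elim osum_SomeE) (rule psum_closed)

lemma osum_commute: "osum A s t = osum A t s"
proof -
  have "psum A x y = psum A y x" if "x \<in> carrier A" "y \<in> carrier A" for x y
    using psum_comm[OF that] psum_comm[OF that(2,1)] by (metis not_Some_eq)
  then show ?thesis by (auto simp: osum_def split: option.splits)
qed

text \<open>The axiom regroups in one direction only, and only when its left side is defined. The
  other direction is the same implication for the reversed arguments, by commutativity.\<close>

lemma osum_assoc: "osum A (osum A s t) u = osum A s (osum A t u)"
proof -
  have le: "osum A (osum A s t) u = Some z \<Longrightarrow> osum A s (osum A t u) = Some z"
    for s t u z
  proof -
    assume "osum A (osum A s t) u = Some z"
    then obtain d w where d: "osum A s t = Some d" and w: "u = Some w" "w \<in> carrier A"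
      and dw: "psum A d w = Some z" by (rule osum_SomeE)
    from d obtain x y where xy: "s = Some x" "t = Some y" "x \<in> carrier A" "y \<in> carrier A"
      "psum A x y = Some d" by (rule osum_SomeE)
    obtain f where f: "psum A y w = Some f" "psum A x f = Some z"
      using psum_assoc[OF xy(3,4) w(2) xy(5) dw] by blast
    then have "f \<in> carrier A" using psum_closed xy w by blast
    then show "osum A s (osum A t u) = Some z" using xy w f by simp
  qed
  show ?thesis
  proof (cases "osum A s (osum A t u)")
    case None
    then show ?thesis using le[of s t u] by (cases "osum A (osum A s t) u") auto
  next
    case (Some z)
    then have "osum A u (osum A t s) = Some z"
      using le[of u t s] by (simp add: osum_commute)
    then show ?thesis using Some by (simp add: osum_commute)
  qed
qed

lemma osum_zero:
  "x \<in> carrier A \<Longrightarrow> osum A (Some (ezero A)) (Some x) = Some x"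
  "x \<in> carrier A \<Longrightarrow> osum A (Some x) (Some (ezero A)) = Some x"
  using osum_commute[of "Some x"] by (simp_all add: ezero_closed psum_ezero)

lemma lsum_in_carrier: "lsum A as = Some x \<Longrightarrow> x \<in> carrier A"
  by (cases as) (auto simp: ezero_closed dest: osum_in_carrier)

lemma lsum_set_carrier: "lsum A as = Some x \<Longrightarrow> set as \<subseteq> carrier A"
  by (induction as arbitrary: x) (auto elim!: osum_SomeE)

lemma lsum_append: "lsum A (as @ bs) = osum A (lsum A as) (lsum A bs)"
proof (induction as)
  case Nil
  show ?case
    by (cases "lsum A bs") (use lsum_in_carrier osum_zero in auto)
qed (simp add: osum_assoc)

lemma lsum_rotate: "as \<noteq> [] \<Longrightarrow> lsum A (last as # butlast as) = lsum A as"
  by (metis append_Cons append_Nil append_butlast_last_id lsum_append osum_commute)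

text \<open>The accumulator is arbitrary for the sake of the induction. It has to lie in the carrier
  because \<open>osum\<close> is undefined elsewhere, whereas \<open>psum\<close> may have values
  there.\<close>

lemma foldl_psum_eq_osum:
  assumes "set bs \<subseteq> carrier A" "\<And>x. s = Some x \<Longrightarrow> x \<in> carrier A"
  shows "foldl (\<lambda>s b. Option.bind s (\<lambda>x. psum A x b)) s bs = osum A s (lsum A bs)"
  using assms
proof (induction bs arbitrary: s)
  case Nil
  then show ?case by (cases s) (simp_all add: osum_zero del: osum_simps(3))
next
  case (Cons b bs)
  have s: "Option.bind s (\<lambda>x. psum A x b) = osum A s (Some b)"
  proof (cases s)
    case (Some x)
    then show ?thesis using Cons.prems(1) Cons.prems(2)[OF Some] by simp
  qed simp
  have "foldl (\<lambda>s b. Option.bind s (\<lambda>x. psum A x b)) (osum A s (Some b)) bs =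
      osum A (osum A s (Some b)) (lsum A bs)"
  proof (rule Cons.IH)
    show "set bs \<subseteq> carrier A" using Cons.prems(1) by simp
  qed (rule osum_in_carrier)
  then show ?case by (simp only: foldl_Cons s osum_assoc lsum_simps)
qed

lemma psum_list_eq_lsum:
  assumes "set as \<subseteq> carrier A"
  shows "psum_list A as = lsum A as"
proof (cases as)
  case (Cons a bs)
  have "foldl (\<lambda>s b. Option.bind s (\<lambda>x. psum A x b)) (Some a) bs = osum A (Some a) (lsum A bs)"
    by (rule foldl_psum_eq_osum) (use assms Cons in auto)
  then show ?thesis by (simp add: Cons)
qed simp

lemma mem_tests_iff:
  "as \<in> tests A n \<longleftrightarrow> length as = Suc n \<and> set as \<subseteq> carrier A \<and> lsum A as = Some (eone A)"
  unfolding tests_def using psum_list_eq_lsum by auto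

end

section \<open>Rotations and merges of tests\<close>

definition rot :: "'a list \<Rightarrow> 'a list" where
  "rot as = last as # butlast as"

lemma length_rot [simp]: "as \<noteq> [] \<Longrightarrow> length (rot as) = length as"
  by (simp add: rot_def)

lemma set_rot [simp]: "as \<noteq> [] \<Longrightarrow> set (rot as) = set as"
  by (cases as rule: rev_cases) (auto simp: rot_def)

lemma map_rot: "as \<noteq> [] \<Longrightarrow> map h (rot as) = rot (map h as)"
  by (simp add: rot_def last_map map_butlast)

lemma nth_rot:
  "k < length as \<Longrightarrow> rot as ! k = (if k = 0 then as ! (length as - 1) else as ! (k - 1))"
  by (auto simp: rot_def nth_Cons last_conv_nth nth_butlast split: nat.splits)

lemma length_merge [simp]: "Suc i < length as \<Longrightarrow> length (merge A i as) = length as - 1"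
  by (simp add: merge_def)

lemma nth_merge:
  assumes "Suc i < length as" "k < length as - 1"
  shows "merge A i as ! k =
    (if k < i then as ! k else if k = i then the (psum A (as ! i) (as ! Suc i)) else as ! Suc k)"
  using assms by (auto simp: merge_def nth_append nth_Cons min_def not_less split: nat.splits)
    (metis add.commute add_Suc_right le_add_diff_inverse)

lemma cyclic_merge_eq:
  assumes "2 \<le> length as"
  shows "cyclic_merge A as = merge A 0 (rot as)"
  using assms by (cases as) (auto simp: cyclic_merge_def merge_def rot_def hd_conv_nth nth_butlast
      drop_Suc butlast_tl nth_Cons')

context effect_algebra
begin

lemma merge_split:
  assumes "Suc i < length as"
  shows "as = take i as @ as ! i # as ! Suc i # drop (Suc (Suc i)) as"
  using assms by (metis Cons_nth_drop_Suc Suc_lessD append_take_drop_id)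

lemma test_nonempty: "as \<in> tests A n \<Longrightarrow> as \<noteq> []"
  by (auto simp: mem_tests_iff)

lemma rot_in_tests: "as \<in> tests A n \<Longrightarrow> rot as \<in> tests A n"
  using test_nonempty[of as n] lsum_rotate[of as]
  by (simp add: mem_tests_iff del: lsum_simps) (simp add: rot_def del: lsum_simps)

text \<open>The total sum is defined, and regrouping isolates the sum of two neighbours, which must
  then be defined too. Hence \<open>the\<close> in \<open>merge\<close> never meets
  \<open>None\<close> on a test.\<close>

lemma test_psum:
  assumes as: "as \<in> tests A n" and i: "i < n"
  obtains c where "psum A (as ! i) (as ! Suc i) = Some c" "c \<in> carrier A"
    "lsum A (take i as @ c # drop (Suc (Suc i)) as) = Some (eone A)"
proof -
  have len: "Suc i < length as" and car: "as ! i \<in> carrier A" "as ! Suc i \<in> carrier A"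
    using as i by (auto simp: mem_tests_iff subset_iff)
  have sum: "lsum A (take i as @ as ! i # as ! Suc i # drop (Suc (Suc i)) as) = Some (eone A)"
    using as by (simp only: merge_split[OF len, symmetric] mem_tests_iff)
  have "osum A (lsum A (take i as)) (osum A (psum A (as ! i) (as ! Suc i))
      (lsum A (drop (Suc (Suc i)) as))) = Some (eone A)"
    using sum car by (simp add: lsum_append flip: osum_assoc)
  moreover from this obtain c where "psum A (as ! i) (as ! Suc i) = Some c"
    by (auto elim!: osum_SomeE)
  ultimately show thesis using that psum_closed[OF car] by (simp add: lsum_append)
qed

lemma merge_in_tests:
  assumes as: "as \<in> tests A (Suc n)" and i: "i \<le> n"
  shows "merge A i as \<in> tests A n"
proof -
  obtain c where c: "psum A (as ! i) (as ! Suc i) = Some c" "c \<in> carrier A"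
    "lsum A (take i as @ c # drop (Suc (Suc i)) as) = Some (eone A)"
    using test_psum[OF as, of i] i by auto
  have "merge A i as = take i as @ c # drop (Suc (Suc i)) as" by (simp add: merge_def c)
  then show ?thesis using as i c(2,3) set_take_subset[of i as] set_drop_subset[of "Suc (Suc i)" as]
    by (auto simp: mem_tests_iff)
qed

text \<open>The simplicial identity for faces. Merges at distant places do not interact; for
  \<open>j = Suc i\<close> both sides add up the same three neighbours, and associativity is
  needed.\<close>

lemma merge_merge:
  assumes as: "as \<in> tests A (Suc (Suc n))" and ij: "i < j" "j \<le> Suc n"
  shows "merge A i (merge A j as) = merge A (j - 1) (merge A i as)"
proof -
  have len: "length as = Suc (Suc (Suc n))" using as by (simp add: mem_tests_iff)
  have assoc: "the (psum A (as ! i) (the (psum A (as ! Suc i) (as ! Suc (Suc i))))) =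
      the (psum A (the (psum A (as ! i) (as ! Suc i))) (as ! Suc (Suc i)))" if "j = Suc i"
  proof -
    have car: "as ! i \<in> carrier A" "as ! Suc i \<in> carrier A" "as ! Suc (Suc i) \<in> carrier A"
      using as ij by (auto simp: mem_tests_iff subset_iff)
    obtain c where c: "psum A (as ! i) (as ! Suc i) = Some c" "c \<in> carrier A"
      using test_psum[OF as, of i] ij by auto
    have m: "merge A i as \<in> tests A (Suc n)" using merge_in_tests[OF as, of i] ij by simp
    obtain d where "psum A (merge A i as ! i) (merge A i as ! Suc i) = Some d"
      using test_psum[OF m, of i] ij that by auto
    then have "psum A c (as ! Suc (Suc i)) = Some d"
      using ij that len c by (simp add: nth_merge)
    then show ?thesis using psum_assoc[OF car c(1)] c by auto
  qed
  show ?thesis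
  proof (rule nth_equalityI, goal_cases)
    case 1
    then show ?case using ij len by simp
  next
    case (2 k)
    then have k: "k < Suc n" using ij len by simp
    consider "j = Suc i" | "Suc i < j" using ij by linarith
    then show ?case
    proof cases
      case 1
      then show ?thesis using assoc k ij len by (simp add: nth_merge)
    next
      case 2
      then obtain j' where j': "j = Suc j'" "i < j'" by (cases j) auto
      then show ?thesis using k ij len by (auto simp: nth_merge)
    qed
  qed
qed

lemma rot_merge:
  assumes "as \<in> tests A (Suc n)" "i < n"
  shows "rot (merge A i as) = merge A (Suc i) (rot as)"
proof (rule nth_equalityI, goal_cases)
  case 1
  then show ?case using assms test_nonempty[OF assms(1)]
      test_nonempty[OF merge_in_tests[OF assms(1), of i]] by (simp add: mem_tests_iff)
next
  case (2 k)
  then show ?case using assms test_nonempty[OF assms(1)]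
      test_nonempty[OF merge_in_tests[OF assms(1), of i]]
    by (auto simp: mem_tests_iff nth_merge nth_rot)
qed

text \<open>The merged entry stands at the end and the rotation brings it to the front. Before
  merging, its two summands have to be brought there one by one, hence two rotations on the
  right.\<close>

lemma rot_merge_last:
  assumes "as \<in> tests A (Suc n)"
  shows "rot (merge A n as) = merge A 0 (rot (rot as))"
proof (rule nth_equalityI, goal_cases)
  case 1
  have "rot as \<noteq> []" by (simp add: rot_def)
  then show ?case using assms test_nonempty[OF assms(1)]
      test_nonempty[OF merge_in_tests[OF assms(1), of n]] by (simp add: mem_tests_iff)
next
  case (2 k)
  have "rot as \<noteq> []" by (simp add: rot_def)
  then show ?case using 2 assms test_nonempty[OF assms(1)]
      test_nonempty[OF merge_in_tests[OF assms(1), of n]]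
    by (auto simp: mem_tests_iff nth_merge nth_rot)
qed

end

section \<open>The cyclic cochain complex\<close>

lemma carrier_cyclic_cochains:
  "\<alpha> \<in> carrier (cyclic_cochains A n) \<longleftrightarrow>
    \<alpha> \<in> extensional (tests A n) \<and> (\<forall>as\<in>tests A n. \<alpha> as = (-1) ^ n * \<alpha> (rot as))"
  by (auto simp: cyclic_cochains_def cochains_def class_ring.func_space_def rot_def PiE_def)

lemma cyclic_cochains_ops [simp]:
  "\<zero>\<^bsub>cyclic_cochains A n\<^esub> = (\<lambda>as\<in>tests A n. 0)"
  "\<alpha> \<oplus>\<^bsub>cyclic_cochains A n\<^esub> \<beta> = (\<lambda>as\<in>tests A n. \<alpha> as + \<beta> as)"
  "r \<odot>\<^bsub>cyclic_cochains A n\<^esub> \<alpha> = (\<lambda>as\<in>tests A n. r * \<alpha> as)"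
  by (simp_all add: cyclic_cochains_def cochains_def class_ring.func_space_def)

text \<open>The cyclic merge is the merge at \<open>0\<close> after a rotation, so that all face identities follow
  from those of \<^const>\<open>merge\<close> and \<^const>\<open>rot\<close>.\<close>

definition face :: "'a effect_alg \<Rightarrow> nat \<Rightarrow> nat \<Rightarrow> 'a list \<Rightarrow> 'a list" where
  "face A n i as = (if i \<le> n then merge A i as else merge A 0 (rot as))"

text \<open>The combinatorial core of the fact that two coboundaries compose to zero: (j, i) -> (i,
  j - 1) matches the terms with i < j with those with j <= i and reverses the sign.\<close>

lemma alternating_double_sum:
  fixes f :: "nat \<Rightarrow> nat \<Rightarrow> real"
  assumes "\<And>i j. i < j \<Longrightarrow> j \<le> Suc N \<Longrightarrow> f i j = f (j - 1) i"
  shows "(\<Sum>j\<le>Suc N. \<Sum>i\<le>N. (-1) ^ (i + j) * f i j) = 0"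
proof -
  let ?g = "\<lambda>(j, i). (-1) ^ (i + j) * f i j"
  let ?L = "{(j, i). i < j \<and> j \<le> Suc N}" and ?U = "{(j, i). j \<le> i \<and> i \<le> N}"
  have fin: "finite ?L" "finite ?U"
    by (rule finite_subset[of _ "{..Suc N} \<times> {..Suc N}"]; auto)+
  have "(\<Sum>j\<le>Suc N. \<Sum>i\<le>N. (-1) ^ (i + j) * f i j) = sum ?g ({..Suc N} \<times> {..N})"
    by (simp add: sum.cartesian_product)
  also have "{..Suc N} \<times> {..N} = ?L \<union> ?U" by auto
  also have "sum ?g \<dots> = sum ?g ?L + sum ?g ?U"
    by (rule sum.union_disjoint) (use fin in auto)
  also have "sum ?g ?L = (\<Sum>x\<in>?U. - ?g x)"
  proof (rule sum.reindex_bij_witness[of _ "\<lambda>(a, b). (Suc b, a)" "\<lambda>(j, i). (i, j - 1)"])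
    fix x assume "x \<in> ?L"
    then obtain i j where x: "x = (Suc j, i)" "i \<le> j" "j \<le> N" by (cases x; cases "fst x") auto
    then show "- ?g (case x of (j, i) \<Rightarrow> (i, j - 1)) = ?g x"
      using assms[of i "Suc j"] by (simp add: add.commute)
  qed auto
  finally show ?thesis by (simp add: sum_negf)
qed

context effect_algebra
begin

lemma coboundary_apply:
  assumes "as \<in> tests A (Suc n)"
  shows "coboundary A n \<alpha> as = (\<Sum>i\<le>Suc n. (-1) ^ i * \<alpha> (face A n i as))"
  using assms by (simp add: coboundary_def face_def cyclic_merge_eq mem_tests_iff)

lemma face_in_tests: "as \<in> tests A (Suc n) \<Longrightarrow> face A n i as \<in> tests A n"
  by (simp add: face_def merge_in_tests rot_in_tests)

text \<open>Cyclic faces become merges of rotated tests, which reduces everything to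
  \<open>merge_merge\<close>. One rotation suffices when only \<open>j\<close> is the cyclic index;
  for \<open>i = Suc n\<close> the outer face on the left is cyclic as well, and the identity is one
  about \<open>rot (rot as)\<close>.\<close>

lemma face_face:
  assumes as: "as \<in> tests A (Suc (Suc n))" and ij: "i < j" "j \<le> Suc (Suc n)"
  shows "face A n i (face A (Suc n) j as) = face A n (j - 1) (face A (Suc n) i as)"
proof -
  note r = rot_in_tests[OF as] and rr = rot_in_tests[OF rot_in_tests[OF as]]
  consider "j \<le> Suc n" | "j = Suc (Suc n)" "i \<le> n" | "j = Suc (Suc n)" "i = Suc n"
    using ij by linarith
  then show ?thesis
  proof cases
    case 1
    then have "i \<le> n" "i \<le> Suc n" "j - 1 \<le> n" using ij by auto
    then show ?thesis using merge_merge[OF as ij(1) 1] 1 by (simp add: face_def)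
  next
    case 2
    then show ?thesis using rot_merge[OF as, of i] merge_merge[OF r, of 0 "Suc i"]
      by (simp add: face_def)
  next
    case 3
    then show ?thesis
      using rot_merge[OF r, of 0] rot_merge_last[OF as] merge_merge[OF rr, of 0 1]
      by (simp add: face_def)
  qed
qed

lemma face_rot:
  assumes "as \<in> tests A (Suc n)"
  shows "face A n 0 (rot as) = face A n (Suc n) as"
    and "i \<le> n \<Longrightarrow> face A n (Suc i) (rot as) = rot (face A n i as)"
  using rot_merge[OF assms, of i] rot_merge_last[OF assms]
  by (auto simp: face_def) (metis le_antisym not_less_eq_eq)

text \<open>By \<open>face_rot\<close>, rotating a test moves its cyclic face to index 0 and the
  other faces up by one, each of them rotated. The shift contributes the sign -1 and cyclicity of
  \<alpha> the sign (-1)^n, together the sign required in degree n + 1.\<close>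

lemma coboundary_in_cyclic:
  assumes \<alpha>: "\<alpha> \<in> carrier (cyclic_cochains A n)"
  shows "coboundary A n \<alpha> \<in> carrier (cyclic_cochains A (Suc n))"
proof -
  have "coboundary A n \<alpha> as = (-1) ^ Suc n * coboundary A n \<alpha> (rot as)"
    if as: "as \<in> tests A (Suc n)" for as
  proof -
    have "coboundary A n \<alpha> (rot as) = \<alpha> (face A n (Suc n) as) +
        (\<Sum>i\<le>n. (-1) ^ Suc i * \<alpha> (rot (face A n i as)))"
      by (subst coboundary_apply[OF rot_in_tests[OF as]], subst sum.atMost_Suc_shift)
        (simp add: face_rot[OF as])
    also have "\<dots> = \<alpha> (face A n (Suc n) as) +
        (\<Sum>i\<le>n. (-1) ^ Suc n * ((-1) ^ i * \<alpha> (face A n i as)))"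
      using \<alpha> face_in_tests[OF as] by (intro arg_cong2[where f = "(+)"] sum.cong refl)
        (simp_all add: carrier_cyclic_cochains)
    finally have "coboundary A n \<alpha> (rot as) = \<alpha> (face A n (Suc n) as) +
        (-1) ^ Suc n * (\<Sum>i\<le>n. (-1) ^ i * \<alpha> (face A n i as))"
      by (simp only: sum_distrib_left)
    moreover have "coboundary A n \<alpha> as = (\<Sum>i\<le>n. (-1) ^ i * \<alpha> (face A n i as)) +
        (-1) ^ Suc n * \<alpha> (face A n (Suc n) as)"
      by (simp add: coboundary_apply[OF as])
    ultimately show ?thesis by (cases "even n") simp_all
  qed
  then show ?thesis by (auto simp: carrier_cyclic_cochains coboundary_def)
qed

lemma coboundary_coboundary:
  "coboundary A (Suc n) (coboundary A n \<alpha>) = (\<lambda>as\<in>tests A (Suc (Suc n)). 0)"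
proof
  fix as
  show "coboundary A (Suc n) (coboundary A n \<alpha>) as = (\<lambda>as\<in>tests A (Suc (Suc n)). 0) as"
  proof (cases "as \<in> tests A (Suc (Suc n))")
    case True
    have "coboundary A (Suc n) (coboundary A n \<alpha>) as =
        (\<Sum>j\<le>Suc (Suc n). \<Sum>i\<le>Suc n. (-1) ^ (i + j) * \<alpha> (face A n i (face A (Suc n) j as)))"
      by (simp only: coboundary_apply True face_in_tests sum_distrib_left power_add mult_ac)
    also have "\<dots> = 0"
      by (rule alternating_double_sum) (simp add: face_face[OF True])
    finally show ?thesis using True by simp
  qed (simp add: coboundary_def)
qed

lemma coboundary_add:
  "coboundary A n (\<lambda>as\<in>tests A n. \<alpha> as + \<beta> as) =
    (\<lambda>as\<in>tests A (Suc n). coboundary A n \<alpha> as + coboundary A n \<beta> as)"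
proof
  show "coboundary A n (\<lambda>as\<in>tests A n. \<alpha> as + \<beta> as) as =
    (\<lambda>as\<in>tests A (Suc n). coboundary A n \<alpha> as + coboundary A n \<beta> as) as" for as
  proof (cases "as \<in> tests A (Suc n)")
    case True
    then show ?thesis
      by (simp add: coboundary_apply face_in_tests sum.distrib distrib_left)
  qed (simp add: coboundary_def)
qed

lemma coboundary_smult:
  "coboundary A n (\<lambda>as\<in>tests A n. r * \<alpha> as) =
    (\<lambda>as\<in>tests A (Suc n). r * coboundary A n \<alpha> as)"
proof
  show "coboundary A n (\<lambda>as\<in>tests A n. r * \<alpha> as) as =
    (\<lambda>as\<in>tests A (Suc n). r * coboundary A n \<alpha> as) as" for as
  proof (cases "as \<in> tests A (Suc n)")
    case True
    then show ?thesis
      by (simp add: coboundary_apply face_in_tests sum_distrib_left algebra_simps)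
  qed (simp add: coboundary_def)
qed

section \<open>Cyclic cochains, cocycles and coboundaries as submodules\<close>

lemma submodule_cyclic_cochains:
  "submodule class_ring (carrier (cyclic_cochains A n)) (cochains A n)"
proof (rule LinearCombinations.submodule.intro)
  show "module class_ring (cochains A n)"
    unfolding cochains_def by (rule class_cring.func_space_is_module)
qed (auto simp: cyclic_cochains_def cochains_def class_ring.func_space_def rot_in_tests
    rot_def[symmetric] algebra_simps)

lemma module_cyclic_cochains: "module class_ring (cyclic_cochains A n)"
proof -
  interpret Module.module class_ring "cochains A n"
    using submodule_cyclic_cochains[of n] by (simp add: LinearCombinations.submodule_def)
  show ?thesis using submodule_is_module[OF submodule_cyclic_cochains]
    by (simp add: cyclic_cochains_def)
qed

lemma submodule_cyclic_cocycles:
  "submodule class_ring (cyclic_cocycles A n) (cyclic_cochains A n)"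
proof -
  interpret Module.module class_ring "cyclic_cochains A n" by (rule module_cyclic_cochains)
  show ?thesis
  proof (rule LinearCombinations.submodule.intro)
    fix \<alpha> \<beta> assume *: "\<alpha> \<in> cyclic_cocycles A n" "\<beta> \<in> cyclic_cocycles A n"
    then have "\<alpha> \<oplus>\<^bsub>cyclic_cochains A n\<^esub> \<beta> \<in> carrier (cyclic_cochains A n)"
      by (intro M.add.m_closed) (auto simp: cyclic_cocycles_def)
    with * show "\<alpha> \<oplus>\<^bsub>cyclic_cochains A n\<^esub> \<beta> \<in> cyclic_cocycles A n"
      by (auto simp: cyclic_cocycles_def coboundary_add)
  next
    fix r and \<alpha> assume *: "\<alpha> \<in> cyclic_cocycles A n"
    then have "r \<odot>\<^bsub>cyclic_cochains A n\<^esub> \<alpha> \<in> carrier (cyclic_cochains A n)"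
      by (intro smult_closed) (auto simp: cyclic_cocycles_def)
    with * show "r \<odot>\<^bsub>cyclic_cochains A n\<^esub> \<alpha> \<in> cyclic_cocycles A n"
      by (auto simp: cyclic_cocycles_def coboundary_smult)
  next
    have "coboundary A n (\<lambda>as\<in>tests A n. 0) = (\<lambda>as\<in>tests A (Suc n). 0)"
      using coboundary_smult[of n 0] by simp
    then show "\<zero>\<^bsub>cyclic_cochains A n\<^esub> \<in> cyclic_cocycles A n"
      using M.zero_closed by (simp add: cyclic_cocycles_def)
  qed (auto simp: cyclic_cocycles_def module_cyclic_cochains)
qed

lemma coboundary_in_cocycles:
  "\<alpha> \<in> carrier (cyclic_cochains A n) \<Longrightarrow> coboundary A n \<alpha> \<in> cyclic_cocycles A (Suc n)"
  by (simp add: cyclic_cocycles_def coboundary_in_cyclic coboundary_coboundary)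

lemma coboundaries_subset_cocycles: "cyclic_coboundaries A (Suc m) \<subseteq> cyclic_cocycles A (Suc m)"
  by (auto simp: cyclic_coboundaries_def coboundary_in_cocycles)

lemma submodule_cyclic_coboundaries:
  "submodule class_ring (cyclic_coboundaries A (Suc m))
    ((cyclic_cochains A (Suc m))\<lparr>carrier := cyclic_cocycles A (Suc m)\<rparr>)"
proof -
  interpret Module.module class_ring "cyclic_cochains A (Suc m)" by (rule module_cyclic_cochains)
  interpret C: Module.module class_ring "cyclic_cochains A m" by (rule module_cyclic_cochains)
  show ?thesis
  proof (rule LinearCombinations.submodule.intro)
    show "module class_ring ((cyclic_cochains A (Suc m))\<lparr>carrier := cyclic_cocycles A (Suc m)\<rparr>)"
      by (rule submodule_is_module[OF submodule_cyclic_cocycles])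
  next
    fix \<alpha> \<beta> assume "\<alpha> \<in> cyclic_coboundaries A (Suc m)" "\<beta> \<in> cyclic_coboundaries A (Suc m)"
    then show "\<alpha> \<oplus>\<^bsub>(cyclic_cochains A (Suc m))\<lparr>carrier := cyclic_cocycles A (Suc m)\<rparr>\<^esub> \<beta>
        \<in> cyclic_coboundaries A (Suc m)"
      using C.M.add.m_closed by (auto simp: cyclic_coboundaries_def simp flip: coboundary_add)
  next
    fix r :: real and \<alpha> assume "\<alpha> \<in> cyclic_coboundaries A (Suc m)"
    then show "r \<odot>\<^bsub>(cyclic_cochains A (Suc m))\<lparr>carrier := cyclic_cocycles A (Suc m)\<rparr>\<^esub> \<alpha>
        \<in> cyclic_coboundaries A (Suc m)"
      using C.smult_closed[of r] by (auto simp: cyclic_coboundaries_def simp flip: coboundary_smult)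
  next
    show "\<zero>\<^bsub>(cyclic_cochains A (Suc m))\<lparr>carrier := cyclic_cocycles A (Suc m)\<rparr>\<^esub>
        \<in> cyclic_coboundaries A (Suc m)"
      using C.M.zero_closed coboundary_smult[of m 0] by (force simp: cyclic_coboundaries_def)
  qed (auto simp: cyclic_coboundaries_def coboundary_in_cocycles)
qed

end

section \<open>Tests with entries zero and one\<close>

definition unit_test :: "'a effect_alg \<Rightarrow> nat \<Rightarrow> nat \<Rightarrow> 'a list" where
  "unit_test A n k = replicate k (ezero A) @ eone A # replicate (n - k) (ezero A)"

lemma length_unit_test [simp]: "k \<le> n \<Longrightarrow> length (unit_test A n k) = Suc n"
  by (simp add: unit_test_def)

lemma nth_unit_test:
  "k \<le> n \<Longrightarrow> i \<le> n \<Longrightarrow> unit_test A n k ! i = (if i = k then eone A else ezero A)"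
  by (auto simp: unit_test_def nth_append nth_Cons split: nat.splits)

lemma rot_unit_test: "k < n \<Longrightarrow> rot (unit_test A n k) = unit_test A n (Suc k)"
  by (rule nth_equalityI) (auto simp: nth_rot nth_unit_test rot_def[symmetric] unit_test_def[symmetric]
    simp flip: length_0_conv)

text \<open>Each rotation moves the entry 1 one place to the right and costs (-1)^n. The resulting
  sign depends only on \<open>n\<close> and \<open>k\<close>, not on the algebra, so cochains on two
  algebras that agree for k = 0 agree for all k.\<close>

lemma cyclic_cochain_unit_test:
  assumes \<alpha>: "\<alpha> \<in> carrier (cyclic_cochains A n)" and u: "\<And>k. k \<le> n \<Longrightarrow> unit_test A n k \<in> tests A n"
    and k: "k \<le> n"
  shows "\<alpha> (unit_test A n k) = (-1) ^ (n * k) * \<alpha> (unit_test A n 0)"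
  using k
proof (induction k)
  case (Suc k)
  have "\<alpha> (unit_test A n k) = (-1) ^ n * \<alpha> (unit_test A n (Suc k))"
    using \<alpha> u[of k] Suc.prems by (simp add: carrier_cyclic_cochains rot_unit_test)
  then have "\<alpha> (unit_test A n (Suc k)) = (-1) ^ n * \<alpha> (unit_test A n k)"
    by (cases "even n") simp_all
  then show ?case using Suc by (simp add: power_add)
qed simp

context effect_algebra
begin

text \<open>If a + b = 0, then (a + b) + 1 is defined, hence so is b + 1, which forces b =
  0.\<close>

lemma psum_eq_zeroD:
  assumes "a \<in> carrier A" "b \<in> carrier A" "psum A a b = Some (ezero A)"
  shows "a = ezero A" "b = ezero A"
proof -
  show b: "b = ezero A"
    using psum_assoc[OF assms(1,2) eone_closed assms(3) psum_ezero[OF eone_closed]]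
      psum_eone[OF assms(2)] by auto
  show "a = ezero A" using assms osum_zero(2)[OF assms(1)] b by (simp add: ezero_closed)
qed

lemma lsum_eq_zeroD:
  assumes "lsum A as = Some (ezero A)" "a \<in> set as"
  shows "a = ezero A"
  using assms
proof (induction as)
  case (Cons b as)
  from Cons.prems(1) obtain x where "b \<in> carrier A" "x \<in> carrier A" "lsum A as = Some x"
    "psum A b x = Some (ezero A)" by (auto elim!: osum_SomeE)
  then show ?case using psum_eq_zeroD[of b x] Cons by auto
qed simp

lemma lsum_replicate_zero: "lsum A (replicate n (ezero A)) = Some (ezero A)"
  by (induction n) (simp_all add: ezero_closed psum_ezero)

lemma unit_test_in_tests: "k \<le> n \<Longrightarrow> unit_test A n k \<in> tests A n"
  by (auto simp: mem_tests_iff unit_test_def lsum_append lsum_replicate_zero osum_zero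
      ezero_closed eone_closed simp del: osum_simps)

text \<open>The entries other than this 1 have a sum \<open>x\<close> for which x + 1 is defined. So
  \<open>x\<close> is 0, and by positivity all these entries are 0.\<close>

lemma test_split_one:
  assumes as: "as \<in> tests A n" and split: "as = xs @ eone A # ys"
  shows "as = unit_test A n (length xs)"
proof -
  have "osum A (osum A (lsum A xs) (lsum A ys)) (Some (eone A)) = Some (eone A)"
    using as by (simp add: split mem_tests_iff lsum_append osum_assoc osum_commute[of "Some (eone A)"])
  then obtain x where x: "osum A (lsum A xs) (lsum A ys) = Some x" "x \<in> carrier A"
    "psum A x (eone A) = Some (eone A)" by (auto elim: osum_SomeE)
  then have "lsum A (xs @ ys) = Some (ezero A)" using psum_eone[of x] by (simp add: lsum_append)
  then have zero: "\<forall>a\<in>set (xs @ ys). a = ezero A" using lsum_eq_zeroD by blast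
  have "xs = replicate (length xs) (ezero A)" "ys = replicate (length ys) (ezero A)"
    using zero by (auto intro!: replicate_eqI)
  moreover have "length ys = n - length xs" using as by (auto simp: split mem_tests_iff)
  ultimately show ?thesis unfolding unit_test_def split by metis
qed

lemma test_zero_one:
  assumes as: "as \<in> tests A n" and "set as \<subseteq> {ezero A, eone A}" and neq: "ezero A \<noteq> eone A"
  obtains k where "k \<le> n" "as = unit_test A n k"
proof -
  have "eone A \<in> set as"
  proof (rule ccontr)
    assume "eone A \<notin> set as"
    then have "as = replicate (length as) (ezero A)"
      using assms(2) by (intro replicate_eqI) auto
    then have "lsum A as = Some (ezero A)" using lsum_replicate_zero by metis
    then show False using as neq by (simp add: mem_tests_iff)
  qed
  then obtain xs ys where split: "as = xs @ eone A # ys" by (auto simp: in_set_conv_decomp)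
  then have "length xs \<le> n" using as by (auto simp: mem_tests_iff)
  then show thesis using that test_split_one[OF as split] by blast
qed

text \<open>Merging at 0 forms 1 + 0, merging further on forms 0 + 0, and the cyclic face forms 0 +
  1 in front; the entry 1 always ends up first.\<close>

lemma face_unit_test: 
  assumes "i \<le> Suc n"
  shows "face A n i (unit_test A (Suc n) 0) = unit_test A n 0"
proof (rule nth_equalityI)
  show "length (face A n i (unit_test A (Suc n) 0)) = length (unit_test A n 0)"
    using face_in_tests[OF unit_test_in_tests[of 0 "Suc n"], of i] by (simp add: mem_tests_iff)
  fix k assume k: "k < length (face A n i (unit_test A (Suc n) 0))"
  have "unit_test A (Suc n) 0 \<noteq> []" by (simp add: unit_test_def)
  with k show "face A n i (unit_test A (Suc n) 0) ! k = unit_test A n 0 ! k"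
    using face_in_tests[OF unit_test_in_tests[of 0 "Suc n"], of i] psum_ezero[OF ezero_closed]
      psum_ezero[OF eone_closed] psum_comm[OF ezero_closed eone_closed psum_ezero[OF eone_closed]]
    by (auto simp: face_def nth_merge nth_rot nth_unit_test mem_tests_iff)
qed

text \<open>All \<open>n + 2\<close> faces coincide, so the value is multiplied by the alternating
  sum of \<open>n + 2\<close> signs.\<close>

lemma coboundary_unit_test:
  "coboundary A n \<alpha> (unit_test A (Suc n) 0) = (if odd n then \<alpha> (unit_test A n 0) else 0)"
proof -
  have sign: "(\<Sum>i\<le>m. (-1) ^ i) = (if even m then 1 else 0 :: real)" for m
    by (induction m) auto
  have "coboundary A n \<alpha> (unit_test A (Suc n) 0) = (\<Sum>i\<le>Suc n. (-1) ^ i) * \<alpha> (unit_test A n 0)"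
    by (simp only: coboundary_apply[OF unit_test_in_tests[of 0 "Suc n", simplified]]
        sum_distrib_right) (intro sum.cong refl, simp add: face_unit_test)
  then show ?thesis unfolding sign by simp
qed

text \<open>At most one entry of a test is \<open>1\<close>, so the sum has at most one nonzero term. The signs
  make the cochain cyclic.\<close>

definition bump :: "nat \<Rightarrow> 'a list \<Rightarrow> real" where
  "bump n = (\<lambda>as\<in>tests A n. \<Sum>k\<le>n. (-1) ^ (n * k) * of_bool (as ! k = eone A))"

lemma bump_in_cyclic: "bump n \<in> carrier (cyclic_cochains A n)"
proof -
  have "bump n as = (-1) ^ n * bump n (rot as)" if as: "as \<in> tests A n" for as
  proof (cases n)
    case 0
    then obtain a where "as = [a]" using as by (auto simp: mem_tests_iff length_Suc_conv)
    then show ?thesis using 0 by (simp add: rot_def)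
  next
    case (Suc m)
    have len: "length as = Suc (Suc m)" using as Suc by (simp add: mem_tests_iff)
    have "bump n (rot as) = (\<Sum>k\<le>n. (-1) ^ (n * k) * of_bool (rot as ! k = eone A))"
      using rot_in_tests[OF as] by (simp add: bump_def)
    \<comment> \<open>Term 0 reads the last entry of \<open>as\<close>. In the other terms, passing
      from k to k + 1 costs a factor (-1)^n.\<close>
    also have "\<dots> = of_bool (as ! n = eone A) +
        (\<Sum>k\<le>m. (-1) ^ n * ((-1) ^ (n * k) * of_bool (as ! k = eone A)))"
      unfolding Suc by (subst sum.atMost_Suc_shift) (simp add: nth_rot len power_add mult_ac)
    also have "\<dots> = of_bool (as ! n = eone A) +
        (-1) ^ n * (\<Sum>k\<le>m. (-1) ^ (n * k) * of_bool (as ! k = eone A))"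
      by (simp only: sum_distrib_left)
    finally have "bump n (rot as) = of_bool (as ! n = eone A) +
        (-1) ^ n * (\<Sum>k\<le>m. (-1) ^ (n * k) * of_bool (as ! k = eone A))" .
    \<comment> \<open>The term for k = n has sign (-1)^(n * n) = (-1)^n.\<close>
    moreover have "bump n as = (\<Sum>k\<le>m. (-1) ^ (n * k) * of_bool (as ! k = eone A)) +
        (-1) ^ n * of_bool (as ! n = eone A)"
      using as by (cases "even n") (simp_all add: bump_def Suc)
    ultimately show ?thesis by (cases "even n") simp_all
  qed
  then show ?thesis by (auto simp: carrier_cyclic_cochains bump_def)
qed

lemma bump_unit_test:
  assumes "ezero A \<noteq> eone A"
  shows "bump n (unit_test A n 0) = 1"
proof -
  have "bump n (unit_test A n 0) =
      (\<Sum>k\<le>n. (-1) ^ (n * k) * of_bool (unit_test A n 0 ! k = eone A))"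
    unfolding bump_def by (rule restrict_apply') (simp add: unit_test_in_tests)
  also have "\<dots> = (\<Sum>k\<le>n. if k = 0 then 1 else 0)"
    using assms by (intro sum.cong) (auto simp: nth_unit_test)
  finally show ?thesis by simp
qed

text \<open>The degree below \<open>n\<close> is odd, so the coboundary of its \<open>bump\<close>
  keeps the value 1. Multiples of it change the value of a cocycle at (1,0,...,0) without changing
  its class.\<close>

lemma coboundary_unit_test_one:
  assumes "ezero A \<noteq> eone A" "even n" "n > 0"
  obtains \<kappa> where "\<kappa> \<in> cyclic_coboundaries A n" "\<kappa> (unit_test A n 0) = 1"
proof -
  obtain m where m: "n = Suc m" "odd m" using assms(2,3) by (cases n) auto
  show thesis
  proof
    show "coboundary A m (bump m) \<in> cyclic_coboundaries A n"
      unfolding m by (simp add: cyclic_coboundaries_def bump_in_cyclic)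
    show "coboundary A m (bump m) (unit_test A n 0) = 1"
      using m assms(1) by (simp add: coboundary_unit_test bump_unit_test)
  qed
qed

lemma cocycle_unit_test_one:
  assumes neq: "ezero A \<noteq> eone A" and n: "even n"
  obtains \<kappa> where "\<kappa> \<in> cyclic_cocycles A n" "\<kappa> (unit_test A n 0) = 1"
proof (cases "n = 0")
  case True
  have one: "as = [eone A]" if "as \<in> tests A 0" for as
    using that osum_zero(2) by (auto simp: mem_tests_iff length_Suc_conv simp del: osum_simps)
  \<comment> \<open>Both faces of a test of degree 1 are (1), and they enter with opposite
    signs.\<close>
  have "coboundary A 0 (bump 0) as = 0" if "as \<in> tests A (Suc 0)" for as
    using one[OF face_in_tests[OF that]] by (simp add: coboundary_apply[OF that])
  then have "bump 0 \<in> cyclic_cocycles A 0"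
    using bump_in_cyclic[of 0] by (auto simp: cyclic_cocycles_def coboundary_def)
  then show thesis using that True bump_unit_test[OF neq] by blast
next
  case False
  then obtain m where m: "n = Suc m" by (cases n) auto
  obtain \<kappa> where \<kappa>: "\<kappa> \<in> cyclic_coboundaries A n" "\<kappa> (unit_test A n 0) = 1"
    using coboundary_unit_test_one neq n False by blast
  then show thesis using that coboundaries_subset_cocycles[of m] m by blast
qed

end

section \<open>Pushouts of effect algebras\<close>

locale effect_hom = A: effect_algebra A + P: effect_algebra P
  for A :: "'a effect_alg" and P :: "'p effect_alg" +
  fixes h :: "'a \<Rightarrow> 'p"
  assumes hom_closed: "a \<in> carrier A \<Longrightarrow> h a \<in> carrier P"
    and hom_psum: "a \<in> carrier A \<Longrightarrow> b \<in> carrier A \<Longrightarrow> psum A a b = Some c \<Longrightarrow>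
      psum P (h a) (h b) = Some (h c)"
    and hom_zero: "h (ezero A) = ezero P"
    and hom_one: "h (eone A) = eone P"
begin

lemma lsum_map: "lsum A as = Some x \<Longrightarrow> lsum P (map h as) = Some (h x)"
proof (induction as arbitrary: x)
  case (Cons a as)
  from Cons.prems obtain y where "a \<in> carrier A" "y \<in> carrier A" "lsum A as = Some y"
    "psum A a y = Some x" by (auto elim!: osum_SomeE)
  then show ?case using Cons.IH hom_psum hom_closed by simp
qed (simp add: hom_zero)

lemma map_in_tests: "as \<in> tests A n \<Longrightarrow> map h as \<in> tests P n"
  using lsum_map[of as "eone A"] hom_closed
  by (auto simp: A.mem_tests_iff P.mem_tests_iff hom_one)

lemma merge_map:
  assumes "as \<in> tests A (Suc n)" "i \<le> n"
  shows "merge P i (map h as) = map h (merge A i as)"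
proof -
  obtain c where "psum A (as ! i) (as ! Suc i) = Some c"
    using A.test_psum[OF assms(1), of i] assms(2) by auto
  moreover have "Suc i < length as" "as ! i \<in> carrier A" "as ! Suc i \<in> carrier A"
    using assms by (auto simp: A.mem_tests_iff subset_iff)
  ultimately show ?thesis using hom_psum
    by (simp add: merge_def take_map drop_map)
qed

lemma face_map:
  assumes "as \<in> tests A (Suc n)"
  shows "face P n i (map h as) = map h (face A n i as)"
  using merge_map[OF assms, of i] merge_map[OF A.rot_in_tests[OF assms], of 0]
    map_rot[OF A.test_nonempty[OF assms], of h]
  by (simp add: face_def)

definition pull :: "nat \<Rightarrow> ('p list \<Rightarrow> real) \<Rightarrow> 'a list \<Rightarrow> real" where
  "pull n \<alpha> = (\<lambda>as\<in>tests A n. \<alpha> (map h as))"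

lemma coboundary_pull: "coboundary A n (pull n \<alpha>) = pull (Suc n) (coboundary P n \<alpha>)"
proof
  show "coboundary A n (pull n \<alpha>) as = pull (Suc n) (coboundary P n \<alpha>) as" for as
  proof (cases "as \<in> tests A (Suc n)")
    case True
    then show ?thesis
      by (simp only: pull_def A.coboundary_apply P.coboundary_apply map_in_tests face_map
          A.face_in_tests restrict_apply' cong: sum.cong)
  qed (simp add: pull_def coboundary_def)
qed

lemma pull_in_cyclic:
  "\<alpha> \<in> carrier (cyclic_cochains P n) \<Longrightarrow> pull n \<alpha> \<in> carrier (cyclic_cochains A n)"
  using map_in_tests A.rot_in_tests A.test_nonempty
  by (simp add: carrier_cyclic_cochains pull_def map_rot)

lemma pull_in_cocycles: "\<alpha> \<in> cyclic_cocycles P n \<Longrightarrow> pull n \<alpha> \<in> cyclic_cocycles A n"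
  unfolding cyclic_cocycles_def
  by (auto simp: pull_in_cyclic coboundary_pull) (auto simp: pull_def map_in_tests)

lemma pull_in_coboundaries:
  "\<alpha> \<in> cyclic_coboundaries P (Suc m) \<Longrightarrow> pull (Suc m) \<alpha> \<in> cyclic_coboundaries A (Suc m)"
  by (auto simp: cyclic_coboundaries_def pull_in_cyclic simp flip: coboundary_pull)

lemma pull_hom:
  "pull n \<in> LinearCombinations.module_hom class_ring
    ((cyclic_cochains P n)\<lparr>carrier := cyclic_cocycles P n\<rparr>)
    ((cyclic_cochains A n)\<lparr>carrier := cyclic_cocycles A n\<rparr>)"
  unfolding LinearCombinations.module_hom_def
  by (auto simp: pull_in_cocycles) (auto simp: pull_def map_in_tests)

lemma pull_unit_test: "pull n \<alpha> (unit_test A n 0) = \<alpha> (unit_test P n 0)"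
  using A.unit_test_in_tests[of 0 n] by (simp add: pull_def unit_test_def hom_zero hom_one)

end

text \<open>The pushout of \<open>A\<close> and \<open>B\<close> over {0,1}, described by properties
  so that the equivalence classes of the coproduct enter only in \<open>coproduct_pushout\<close>.
  By \<open>psum_cases\<close> no sum mixes the two sides.\<close>

locale effect_pushout = l: effect_hom A P l + r: effect_hom B P r
  for A :: "'a effect_alg" and B :: "'b effect_alg" and P :: "'p effect_alg" and l r +
  assumes neq: "ezero A \<noteq> eone A" "ezero B \<noteq> eone B"
    and inj: "inj_on l (carrier A)" "inj_on r (carrier B)"
    and overlap: "\<And>a b. a \<in> carrier A \<Longrightarrow> b \<in> carrier B \<Longrightarrow> l a = r b \<Longrightarrow>
      a = ezero A \<and> b = ezero B \<or> a = eone A \<and> b = eone B"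
    and psum_cases: "\<And>p q s. psum P p q = Some s \<Longrightarrow>
      (\<exists>a\<in>carrier A. \<exists>a'\<in>carrier A. \<exists>c. p = l a \<and> q = l a' \<and> psum A a a' = Some c \<and> s = l c) \<or>
      (\<exists>b\<in>carrier B. \<exists>b'\<in>carrier B. \<exists>c. p = r b \<and> q = r b' \<and> psum B b b' = Some c \<and> s = r c)"
begin

text \<open>Lets \<open>lsum_step\<close>, proved for lists from \<open>A\<close>, be applied to
  lists from \<open>B\<close>.\<close>

lemma pushout_sym: "effect_pushout B A P r l"
proof (intro effect_pushout.intro effect_pushout_axioms.intro)
  show "b = ezero B \<and> a = ezero A \<or> b = eone B \<and> a = eone A"
    if "b \<in> carrier B" "a \<in> carrier A" "r b = l a" for a b
    using overlap[of a b] that by auto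
  show "(\<exists>b\<in>carrier B. \<exists>b'\<in>carrier B. \<exists>c. p = r b \<and> q = r b' \<and> psum B b b' = Some c \<and> s = r c) \<or>
      (\<exists>a\<in>carrier A. \<exists>a'\<in>carrier A. \<exists>c. p = l a \<and> q = l a' \<and> psum A a a' = Some c \<and> s = l c)"
    if "psum P p q = Some s" for p q s
    using psum_cases[OF that] by blast
  show "effect_hom B P r" by (rule r.effect_hom_axioms)
  show "effect_hom A P l" by (rule l.effect_hom_axioms)
qed (rule neq inj)+

lemma zero_one_eq: "l (ezero A) = r (ezero B)" "l (eone A) = r (eone B)"
  by (simp_all add: l.hom_zero l.hom_one r.hom_zero r.hom_one)

text \<open>The new sum may be computed in \<open>B\<close> although the list comes from
  \<open>A\<close>. Then \<open>l x\<close> lies in both images, so \<open>x\<close> is 0 or 1. If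
  it is 0, all entries of \<open>as\<close> are 0 and the whole list can be read in
  \<open>B\<close>. If it is 1, the new entry must be 0 and can be read in \<open>A\<close>.\<close>

lemma lsum_step:
  assumes as: "lsum A as = Some x" and p: "psum P p (l x) = Some z"
  shows "(\<exists>as' c. lsum A as' = Some c \<and> p # map l as = map l as' \<and> z = l c) \<or>
    (\<exists>bs c. lsum B bs = Some c \<and> p # map l as = map r bs \<and> z = r c)"
  using psum_cases[OF p]
proof (elim disjE bexE exE conjE)
  fix a a' c assume *: "a \<in> carrier A" "a' \<in> carrier A" "p = l a" "l x = l a'"
    "psum A a a' = Some c" "z = l c"
  have x: "x \<in> carrier A" using l.A.lsum_in_carrier[OF as] .
  then have "x = a'" using * inj(1) by (auto dest: inj_onD)
  then have "lsum A (a # as) = Some c" using as * by simp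
  moreover have "p # map l as = map l (a # as)" using * by simp
  ultimately show ?thesis using *(6) by (intro disjI1 exI[of _ "a # as"] exI[of _ c] conjI)
next
  fix b b' c assume *: "b \<in> carrier B" "b' \<in> carrier B" "p = r b" "l x = r b'"
    "psum B b b' = Some c" "z = r c"
  have x: "x \<in> carrier A" using l.A.lsum_in_carrier[OF as] .
  consider "x = ezero A" "b' = ezero B" | "x = eone A" "b' = eone B"
    using overlap[OF x *(2,4)] by blast
  then show ?thesis
  proof cases
    case 1
    then have "as = replicate (length as) (ezero A)"
      using l.A.lsum_eq_zeroD as by (intro replicate_eqI) auto
    then have "map l as = map r (replicate (length as) (ezero B))"
      by (metis map_replicate zero_one_eq(1))
    moreover have "lsum B (b # replicate (length as) (ezero B)) = Some c"
      using * 1 by (simp add: r.A.lsum_replicate_zero)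
    ultimately show ?thesis using * by (metis list.simps(9))
  next
    case 2
    then have b: "b = ezero B" using * r.A.psum_eone[of b] by simp
    then have "c = eone B" using * 2 r.A.psum_ezero[of b'] by simp
    moreover have "lsum A (ezero A # as) = Some (eone A)"
      using as 2 l.A.osum_zero(1)[OF x] by simp
    ultimately show ?thesis using * b zero_one_eq by (metis list.simps(9))
  qed
qed

text \<open>Sums other than 1 are included because the induction passes to suffixes of a
  test.\<close>

lemma lsum_cases:
  assumes "lsum P ps = Some z"
  shows "(\<exists>as x. lsum A as = Some x \<and> ps = map l as \<and> z = l x) \<or>
    (\<exists>bs y. lsum B bs = Some y \<and> ps = map r bs \<and> z = r y)"
  using assms
proof (induction ps arbitrary: z)
  case Nil
  then show ?case using l.hom_zero by (intro disjI1 exI[of _ "[]"] exI[of _ "ezero A"]) simp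
next
  case (Cons p ps)
  from Cons.prems obtain y where y: "lsum P ps = Some y" and z: "psum P p y = Some z"
    by (auto elim!: osum_SomeE)
  show ?case using Cons.IH[OF y]
  proof (elim disjE exE conjE)
    fix as x assume *: "lsum A as = Some x" "ps = map l as" "y = l x"
    show ?thesis using lsum_step[OF *(1) z[unfolded *(3)]] unfolding *(2) .
  next
    fix bs x assume *: "lsum B bs = Some x" "ps = map r bs" "y = r x"
    show ?thesis using effect_pushout.lsum_step[OF pushout_sym *(1) z[unfolded *(3)]]
      unfolding *(2) by (rule disj_commute[THEN iffD1])
  qed
qed

end

section \<open>Tests, cochains and cohomology of the pushout\<close>

context effect_pushout
begin

lemma tests_cases:
  assumes "ps \<in> tests P n"
  obtains (left) as where "as \<in> tests A n" "ps = map l as"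
  | (right) bs where "bs \<in> tests B n" "ps = map r bs"
proof -
  have len: "length ps = Suc n" and one: "lsum P ps = Some (eone P)"
    using assms by (simp_all add: l.P.mem_tests_iff)
  from lsum_cases[OF one] show thesis
  proof (elim disjE exE conjE)
    fix as x assume *: "lsum A as = Some x" "ps = map l as" "eone P = l x"
    then have "x = eone A" using inj(1) l.A.lsum_in_carrier[of as x] l.hom_one l.A.eone_closed
      by (auto dest: inj_onD)
    then show thesis using left[of as] * len l.A.lsum_set_carrier by (auto simp: l.A.mem_tests_iff)
  next
    fix bs x assume *: "lsum B bs = Some x" "ps = map r bs" "eone P = r x"
    then have "x = eone B" using inj(2) r.A.lsum_in_carrier[of bs x] r.hom_one r.A.eone_closed
      by (auto dest: inj_onD)
    then show thesis using right[of bs] * len r.A.lsum_set_carrier by (auto simp: r.A.mem_tests_iff)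
  qed
qed

lemma overlap_tests:
  assumes as: "as \<in> tests A n" and bs: "bs \<in> tests B n" and eq: "map l as = map r bs"
  obtains k where "k \<le> n" "as = unit_test A n k" "bs = unit_test B n k"
proof -
  have len: "length as = Suc n" "length bs = Suc n"
    and car: "set as \<subseteq> carrier A" "set bs \<subseteq> carrier B"
    using as bs by (simp_all add: l.A.mem_tests_iff r.A.mem_tests_iff)
  have entries: "as ! i = ezero A \<and> bs ! i = ezero B \<or> as ! i = eone A \<and> bs ! i = eone B"
    if "i \<le> n" for i
  proof (rule overlap)
    show "as ! i \<in> carrier A" "bs ! i \<in> carrier B" using that len car by (auto simp: subset_iff)
    show "l (as ! i) = r (bs ! i)" using arg_cong[OF eq, of "\<lambda>xs. xs ! i"] len that by simp
  qed
  have "set as \<subseteq> {ezero A, eone A}"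
  proof
    fix a assume "a \<in> set as"
    then obtain i where "i \<le> n" "a = as ! i" by (auto simp: in_set_conv_nth len less_Suc_eq_le)
    then show "a \<in> {ezero A, eone A}" using entries[of i] by auto
  qed
  then obtain k where k: "k \<le> n" "as = unit_test A n k"
    using l.A.test_zero_one[OF as _ neq(1)] by blast
  moreover have "bs = unit_test B n k"
  proof (rule nth_equalityI)
    fix i assume "i < length bs"
    then show "bs ! i = unit_test B n k ! i"
      using entries[of i] neq k by (auto simp: len nth_unit_test)
  qed (use len k in simp)
  ultimately show thesis using that by blast
qed

text \<open>Exactness on the left: every test of \<open>P\<close> comes from one of the two
  sides.\<close>

lemma cochain_eqI:
  assumes "\<alpha> \<in> extensional (tests P n)" "\<alpha>' \<in> extensional (tests P n)"
    and "l.pull n \<alpha> = l.pull n \<alpha>'" "r.pull n \<alpha> = r.pull n \<alpha>'"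
  shows "\<alpha> = \<alpha>'"
proof (rule extensionalityI[OF assms(1,2)])
  fix ps assume "ps \<in> tests P n"
  then show "\<alpha> ps = \<alpha>' ps"
  proof (cases rule: tests_cases)
    case (left as)
    then show ?thesis using fun_cong[OF assms(3), of as] by (simp add: l.pull_def)
  next
    case (right bs)
    then show ?thesis using fun_cong[OF assms(4), of bs] by (simp add: r.pull_def)
  qed
qed

text \<open>Exactness in the middle. The common tests form a single orbit under rotation, so
  cyclicity extends the agreement at (1,0,...,0) to all of them.\<close>

lemma glue_cochains:
  assumes \<beta>: "\<beta> \<in> carrier (cyclic_cochains A n)" and \<gamma>: "\<gamma> \<in> carrier (cyclic_cochains B n)"
    and agree: "\<beta> (unit_test A n 0) = \<gamma> (unit_test B n 0)"
  obtains \<alpha> where "\<alpha> \<in> carrier (cyclic_cochains P n)" "l.pull n \<alpha> = \<beta>" "r.pull n \<alpha> = \<gamma>"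
proof -
  \<comment> \<open>Tests that come from both sides are evaluated by \<beta>; \<open>pull_r\<close>
    checks that \<gamma> gives the same value there.\<close>
  define \<alpha> where "\<alpha> = (\<lambda>ps\<in>tests P n. if \<exists>as\<in>tests A n. ps = map l as
    then \<beta> (map (inv_into (carrier A) l) ps) else \<gamma> (map (inv_into (carrier B) r) ps))"
  have pull_l: "\<alpha> (map l as) = \<beta> as" if "as \<in> tests A n" for as
  proof -
    have "map (inv_into (carrier A) l) (map l as) = as"
      using that inj(1) by (auto simp: l.A.mem_tests_iff subset_iff intro!: map_idI)
    then show ?thesis using that l.map_in_tests by (auto simp: \<alpha>_def simp del: map_map)
  qed
  have pull_r: "\<alpha> (map r bs) = \<gamma> bs" if bs: "bs \<in> tests B n" for bs
  proof (cases "\<exists>as\<in>tests A n. map r bs = map l as")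
    case True
    then obtain as where as: "as \<in> tests A n" "map l as = map r bs" by auto
    then obtain k where k: "k \<le> n" "as = unit_test A n k" "bs = unit_test B n k"
      using overlap_tests bs by blast
    have "\<alpha> (map r bs) = \<beta> as" using pull_l as by metis
    also have "\<dots> = \<gamma> bs" unfolding k(2,3)
      using cyclic_cochain_unit_test[OF \<beta> l.A.unit_test_in_tests k(1)]
        cyclic_cochain_unit_test[OF \<gamma> r.A.unit_test_in_tests k(1)] agree by simp
    finally show ?thesis .
  next
    case False
    have "map (inv_into (carrier B) r) (map r bs) = bs"
      using that inj(2) by (auto simp: r.A.mem_tests_iff subset_iff intro!: map_idI)
    then show ?thesis using False that r.map_in_tests by (auto simp: \<alpha>_def simp del: map_map)
  qed
  have "\<alpha> ps = (-1) ^ n * \<alpha> (rot ps)" if "ps \<in> tests P n" for ps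
    using that
  proof (cases rule: tests_cases)
    case (left as)
    have "\<beta> as = (-1) ^ n * \<beta> (rot as)"
      using \<beta> left(1) unfolding carrier_cyclic_cochains by blast
    also have "\<beta> (rot as) = \<alpha> (rot ps)"
      using pull_l[OF l.A.rot_in_tests[OF left(1)]] map_rot[OF l.A.test_nonempty[OF left(1)], of l]
      by (simp add: left(2))
    finally show ?thesis by (simp only: left(2) pull_l[OF left(1)])
  next
    case (right bs)
    have "\<gamma> bs = (-1) ^ n * \<gamma> (rot bs)"
      using \<gamma> right(1) unfolding carrier_cyclic_cochains by blast
    also have "\<gamma> (rot bs) = \<alpha> (rot ps)"
      using pull_r[OF r.A.rot_in_tests[OF right(1)]] map_rot[OF r.A.test_nonempty[OF right(1)], of r]
      by (simp add: right(2))
    finally show ?thesis by (simp only: right(2) pull_r[OF right(1)])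
  qed
  then have "\<alpha> \<in> carrier (cyclic_cochains P n)" by (auto simp: carrier_cyclic_cochains \<alpha>_def)
  moreover have "l.pull n \<alpha> = \<beta>"
    by (rule extensionalityI[of _ "tests A n"])
      (use \<beta> in \<open>auto simp: l.pull_def pull_l carrier_cyclic_cochains\<close>)
  moreover have "r.pull n \<alpha> = \<gamma>"
    by (rule extensionalityI[of _ "tests B n"])
      (use \<gamma> in \<open>auto simp: r.pull_def pull_r carrier_cyclic_cochains\<close>)
  ultimately show thesis using that by blast
qed

text \<open>Restriction commutes with the coboundary, so both restrictions of the coboundary of the
  glued cochain vanish, and \<open>cochain_eqI\<close> applies.\<close>

lemma glue_cocycles:
  assumes \<beta>: "\<beta> \<in> cyclic_cocycles A n" and \<gamma>: "\<gamma> \<in> cyclic_cocycles B n"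
    and agree: "\<beta> (unit_test A n 0) = \<gamma> (unit_test B n 0)"
  obtains \<alpha> where "\<alpha> \<in> cyclic_cocycles P n" "l.pull n \<alpha> = \<beta>" "r.pull n \<alpha> = \<gamma>"
proof -
  obtain \<alpha> where \<alpha>: "\<alpha> \<in> carrier (cyclic_cochains P n)" "l.pull n \<alpha> = \<beta>" "r.pull n \<alpha> = \<gamma>"
    using glue_cochains[of \<beta> n \<gamma>] assms by (auto simp: cyclic_cocycles_def)
  have "coboundary P n \<alpha> = (\<lambda>ps\<in>tests P (Suc n). 0)"
  proof (rule cochain_eqI)
    show "l.pull (Suc n) (coboundary P n \<alpha>) = l.pull (Suc n) (\<lambda>ps\<in>tests P (Suc n). 0)"
      using \<beta> \<alpha> by (simp add: cyclic_cocycles_def flip: l.coboundary_pull)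
        (auto simp: l.pull_def l.map_in_tests)
    show "r.pull (Suc n) (coboundary P n \<alpha>) = r.pull (Suc n) (\<lambda>ps\<in>tests P (Suc n). 0)"
      using \<gamma> \<alpha> by (simp add: cyclic_cocycles_def flip: r.coboundary_pull)
        (auto simp: r.pull_def r.map_in_tests)
  qed (auto simp: coboundary_def)
  then show thesis using that \<alpha> by (simp add: cyclic_cocycles_def)
qed

lemma coboundary_if_pulls:
  assumes \<alpha>: "\<alpha> \<in> cyclic_cocycles P (Suc m)"
    and L: "l.pull (Suc m) \<alpha> \<in> cyclic_coboundaries A (Suc m)"
    and R: "r.pull (Suc m) \<alpha> \<in> cyclic_coboundaries B (Suc m)"
  shows "\<alpha> \<in> cyclic_coboundaries P (Suc m)"
proof -
  obtain \<beta> \<gamma> where \<beta>: "\<beta> \<in> carrier (cyclic_cochains A m)" "l.pull (Suc m) \<alpha> = coboundary A m \<beta>"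
    and \<gamma>: "\<gamma> \<in> carrier (cyclic_cochains B m)" "r.pull (Suc m) \<alpha> = coboundary B m \<gamma>"
    using L R by (auto simp: cyclic_coboundaries_def)
  obtain \<beta>' where \<beta>': "\<beta>' \<in> carrier (cyclic_cochains A m)" "coboundary A m \<beta>' = coboundary A m \<beta>"
    "\<beta>' (unit_test A m 0) = \<gamma> (unit_test B m 0)"
  proof (cases "odd m")
    \<comment> \<open>In odd degree the values of \<beta> and \<gamma> at (1,0,...,0) can be read
      off from their coboundaries. Both of these are restrictions of \<alpha>, so the values agree
      already.\<close>
    case True
    then have "\<beta> (unit_test A m 0) = \<gamma> (unit_test B m 0)"
      using l.pull_unit_test[of "Suc m" \<alpha>] r.pull_unit_test[of "Suc m" \<alpha>]
      by (simp add: \<beta> \<gamma> l.A.coboundary_unit_test r.A.coboundary_unit_test)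
    then show thesis using that \<beta> by blast
  next
    case False
    \<comment> \<open>The mismatch at (1,0,...,0). Since \<kappa> is a cocycle with value 1 there,
      adding \<open>?c\<close> times \<kappa> repairs it and leaves the coboundary of \<beta>
      unchanged.\<close>
    let ?c = "\<gamma> (unit_test B m 0) - \<beta> (unit_test A m 0)"
    obtain \<kappa> where \<kappa>: "\<kappa> \<in> cyclic_cocycles A m" "\<kappa> (unit_test A m 0) = 1"
      using l.A.cocycle_unit_test_one[OF neq(1)] False by blast
    interpret C: Module.module class_ring "cyclic_cochains A m" by (rule l.A.module_cyclic_cochains)
    let ?\<beta> = "\<beta> \<oplus>\<^bsub>cyclic_cochains A m\<^esub> (?c \<odot>\<^bsub>cyclic_cochains A m\<^esub> \<kappa>)"
    have "?\<beta> \<in> carrier (cyclic_cochains A m)"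
      using \<beta> \<kappa> by (intro C.M.add.m_closed C.smult_closed) (auto simp: cyclic_cocycles_def)
    moreover have "coboundary A m ?\<beta> = coboundary A m \<beta>"
    proof -
      have "coboundary A m ?\<beta> = (\<lambda>as\<in>tests A (Suc m). coboundary A m \<beta> as)"
        unfolding cyclic_cochains_ops l.A.coboundary_add l.A.coboundary_smult
        using \<kappa> by (intro restrict_ext) (simp add: cyclic_cocycles_def)
      also have "\<dots> = coboundary A m \<beta>"
        unfolding coboundary_def by (rule extensional_restrict) (rule restrict_extensional)
      finally show ?thesis .
    qed
    moreover have "?\<beta> (unit_test A m 0) = \<gamma> (unit_test B m 0)"
      using \<kappa> l.A.unit_test_in_tests[of 0 m] by simp
    ultimately show thesis using that by blast
  qed
  then obtain \<eta> where \<eta>: "\<eta> \<in> carrier (cyclic_cochains P m)" "l.pull m \<eta> = \<beta>'" "r.pull m \<eta> = \<gamma>"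
    using glue_cochains \<gamma> by blast
  have "\<alpha> = coboundary P m \<eta>"
  proof (rule cochain_eqI)
    show "\<alpha> \<in> extensional (tests P (Suc m))"
      using \<alpha> by (simp add: cyclic_cocycles_def carrier_cyclic_cochains)
    show "l.pull (Suc m) \<alpha> = l.pull (Suc m) (coboundary P m \<eta>)"
      using \<beta> \<beta>' \<eta> by (simp flip: l.coboundary_pull)
    show "r.pull (Suc m) \<alpha> = r.pull (Suc m) (coboundary P m \<eta>)"
      using \<gamma> \<eta> by (simp flip: r.coboundary_pull)
  qed (simp add: coboundary_def)
  then show ?thesis using \<eta> by (simp add: cyclic_coboundaries_def)
qed

text \<open>In odd degree this value equals the value of the coboundary of \<alpha> at the longer
  test (1,0,...,0), which is zero.\<close>

lemma cocycle_unit_test_odd: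
  assumes "effect_algebra E" "\<alpha> \<in> cyclic_cocycles E n" "odd n"
  shows "\<alpha> (unit_test E n 0) = 0"
  using effect_algebra.coboundary_unit_test[OF assms(1), of n \<alpha>] assms(2,3)
    effect_algebra.unit_test_in_tests[OF assms(1), of 0 "Suc n"]
  by (simp add: cyclic_cocycles_def)

text \<open>Only \<beta> is corrected. In odd degree both cocycles vanish at (1,0,...,0) and
  \<open>b\<close> is zero; in even degree \<open>b\<close> is the multiple of a coboundary with
  value 1 there that cancels the mismatch.\<close>

lemma cocycles_lift:
  assumes \<beta>: "\<beta> \<in> cyclic_cocycles A n" and \<gamma>: "\<gamma> \<in> cyclic_cocycles B n" and n: "n > 0"
  obtains \<alpha> b where "\<alpha> \<in> cyclic_cocycles P n" "b \<in> cyclic_coboundaries A n"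
    "l.pull n \<alpha> = b \<oplus>\<^bsub>cyclic_cochains A n\<^esub> \<beta>" "r.pull n \<alpha> = \<gamma>"
proof -
  obtain m where m: "n = Suc m" using n by (cases n) auto
  interpret N: LinearCombinations.submodule class_ring "cyclic_coboundaries A n"
    "(cyclic_cochains A n)\<lparr>carrier := cyclic_cocycles A n\<rparr>"
    unfolding m by (rule l.A.submodule_cyclic_coboundaries)
  interpret Z: LinearCombinations.submodule class_ring "cyclic_cocycles A n" "cyclic_cochains A n"
    by (rule l.A.submodule_cyclic_cocycles)
  have sub: "cyclic_coboundaries A n \<subseteq> cyclic_cocycles A n"
    unfolding m by (rule l.A.coboundaries_subset_cocycles)
  obtain b where b: "b \<in> cyclic_coboundaries A n"
    "b (unit_test A n 0) + \<beta> (unit_test A n 0) = \<gamma> (unit_test B n 0)"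
  proof (cases "odd n")
    case True
    have "\<zero>\<^bsub>cyclic_cochains A n\<^esub> \<in> cyclic_coboundaries A n" using N.zero_closed by simp
    then show thesis using that[of "\<zero>\<^bsub>cyclic_cochains A n\<^esub>"] True
      cocycle_unit_test_odd[OF l.A.effect_algebra_axioms \<beta>]
      cocycle_unit_test_odd[OF r.A.effect_algebra_axioms \<gamma>] l.A.unit_test_in_tests[of 0 n] by simp
  next
    case False
    let ?c = "\<gamma> (unit_test B n 0) - \<beta> (unit_test A n 0)"
    obtain \<kappa> where \<kappa>: "\<kappa> \<in> cyclic_coboundaries A n" "\<kappa> (unit_test A n 0) = 1"
      using l.A.coboundary_unit_test_one[OF neq(1)] False n by blast
    have "?c \<odot>\<^bsub>cyclic_cochains A n\<^esub> \<kappa> \<in> cyclic_coboundaries A n"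
      using N.smult_closed[of ?c \<kappa>] \<kappa> by simp
    then show thesis
      using that[of "?c \<odot>\<^bsub>cyclic_cochains A n\<^esub> \<kappa>"] \<kappa> l.A.unit_test_in_tests[of 0 n] by simp
  qed
  have "b \<oplus>\<^bsub>cyclic_cochains A n\<^esub> \<beta> \<in> cyclic_cocycles A n"
    using b sub \<beta> by (intro Z.m_closed) auto
  moreover have "(b \<oplus>\<^bsub>cyclic_cochains A n\<^esub> \<beta>) (unit_test A n 0) = \<gamma> (unit_test B n 0)"
    using b l.A.unit_test_in_tests[of 0 n] by simp
  ultimately show thesis using glue_cocycles \<gamma> that b(1) by blast
qed

lemma HC_pushout:
  assumes "n > 0"
  shows "vs_iso class_ring (HC P n) (direct_sum (HC A n) (HC B n))"
proof -
  obtain m where m: "n = Suc m" using assms by (cases n) auto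
  interpret N: LinearCombinations.submodule class_ring "cyclic_coboundaries B n"
    "(cyclic_cochains B n)\<lparr>carrier := cyclic_cocycles B n\<rparr>"
    unfolding m by (rule r.A.submodule_cyclic_coboundaries)
  show ?thesis
    unfolding HC_def
  proof (rule vs_iso_quotient_direct_sum[where f = "l.pull n" and g = "r.pull n"])
    fix \<beta> \<gamma>
    assume "\<beta> \<in> carrier ((cyclic_cochains A n)\<lparr>carrier := cyclic_cocycles A n\<rparr>)"
      "\<gamma> \<in> carrier ((cyclic_cochains B n)\<lparr>carrier := cyclic_cocycles B n\<rparr>)"
    then have \<beta>: "\<beta> \<in> cyclic_cocycles A n" and \<gamma>: "\<gamma> \<in> cyclic_cocycles B n" by simp_all
    obtain \<alpha> b where \<alpha>: "\<alpha> \<in> cyclic_cocycles P n" "b \<in> cyclic_coboundaries A n"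
      "l.pull n \<alpha> = b \<oplus>\<^bsub>cyclic_cochains A n\<^esub> \<beta>" "r.pull n \<alpha> = \<gamma>"
      using cocycles_lift[OF \<beta> \<gamma> assms] by blast
    \<comment> \<open>On the side of \<open>B\<close> the correcting coboundary is zero. Addition of
      cochains cuts off outside the tests, so this equation rests on \<gamma> being
      extensional.\<close>
    have "\<gamma> = \<zero>\<^bsub>cyclic_cochains B n\<^esub> \<oplus>\<^bsub>cyclic_cochains B n\<^esub> \<gamma>"
      by (rule extensionalityI[of _ "tests B n"])
        (use \<gamma> in \<open>simp_all add: cyclic_cocycles_def carrier_cyclic_cochains\<close>)
    then show "\<exists>\<alpha>\<in>carrier ((cyclic_cochains P n)\<lparr>carrier := cyclic_cocycles P n\<rparr>).
      \<exists>b\<in>cyclic_coboundaries A n. \<exists>c\<in>cyclic_coboundaries B n.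
        l.pull n \<alpha> = b \<oplus>\<^bsub>(cyclic_cochains A n)\<lparr>carrier := cyclic_cocycles A n\<rparr>\<^esub> \<beta> \<and>
        r.pull n \<alpha> = c \<oplus>\<^bsub>(cyclic_cochains B n)\<lparr>carrier := cyclic_cocycles B n\<rparr>\<^esub> \<gamma>"
      using \<alpha> N.zero_closed by (intro bexI[of _ \<alpha>] bexI[of _ b] bexI[of _ "\<zero>\<^bsub>cyclic_cochains B n\<^esub>"]) auto
  next
    fix \<alpha> assume "\<alpha> \<in> carrier ((cyclic_cochains P n)\<lparr>carrier := cyclic_cocycles P n\<rparr>)"
    then show "\<alpha> \<in> cyclic_coboundaries P n \<longleftrightarrow>
        l.pull n \<alpha> \<in> cyclic_coboundaries A n \<and> r.pull n \<alpha> \<in> cyclic_coboundaries B n"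
      using coboundary_if_pulls[of \<alpha> m] l.pull_in_coboundaries r.pull_in_coboundaries
      by (auto simp: m)
  qed (use m class_field l.pull_hom r.pull_hom l.A.submodule_cyclic_coboundaries
      r.A.submodule_cyclic_coboundaries l.P.submodule_cyclic_coboundaries in auto)
qed

end

text \<open>\<open>psum\<close> of the coproduct is a definite description, so it agrees with
  \<open>coprod_psum_rel\<close> once that relation is shown to be single-valued; the remaining
  properties are read off from explicit classes.\<close>

lemma coproduct_pushout:
  assumes A: "effect_algebra A" "ezero A \<noteq> eone A" and B: "effect_algebra B" "ezero B \<noteq> eone B"
  shows "effect_pushout A B (coproduct A B) (coprod_inl A B) (coprod_inr A B)"
proof -
  let ?l = "coprod_inl A B" and ?r = "coprod_inr A B" and ?R = "coprod_psum_rel A B"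
  interpret A: effect_algebra A by fact
  interpret B: effect_algebra B by fact
  interpret P: effect_algebra "coproduct A B" by (rule coproduct_effect_algebra[OF A B])
  note mem = A.ezero_closed A.eone_closed B.ezero_closed B.eone_closed
  note re = coprod_rel_eq[OF A B]
  have l: "?l a = (if a = ezero A then {Inl a, Inr (ezero B)} else
      if a = eone A then {Inl a, Inr (eone B)} else {Inl a})" if "a \<in> carrier A" for a
    unfolding coprod_inl_def re using that A(2) B(2) by auto
  have r: "?r b = (if b = ezero B then {Inl (ezero A), Inr b} else
      if b = eone B then {Inl (eone A), Inr b} else {Inr b})" if "b \<in> carrier B" for b
    unfolding coprod_inr_def re using that A(2) B(2) by auto
  have injl: "inj_on ?l (carrier A)"
    by (rule inj_onI) (auto simp: l split: if_splits)
  have injr: "inj_on ?r (carrier B)"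
    by (rule inj_onI) (auto simp: r split: if_splits)
  have overlap: "a = ezero A \<and> b = ezero B \<or> a = eone A \<and> b = eone B"
    if "a \<in> carrier A" "b \<in> carrier B" "?l a = ?r b" for a b
    using that A(2) B(2) by (simp add: l r split: if_splits) (auto split: if_splits)
  have z: "?r (ezero B) = ?l (ezero A)" "?r (eone B) = ?l (eone A)"
    using A(2) B(2) by (simp_all add: l r mem)
  have none: "psum A (eone A) (eone A) = None" "psum B (eone B) (eone B) = None"
    using A.psum_eone[OF mem(2)] B.psum_eone[OF mem(4)] A(2) B(2) by metis+
  have sums: "psum A (ezero A) (ezero A) = Some (ezero A)" "psum A (ezero A) (eone A) = Some (eone A)"
    "psum A (eone A) (ezero A) = Some (eone A)"
    "psum B (ezero B) (ezero B) = Some (ezero B)" "psum B (ezero B) (eone B) = Some (eone B)"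
    "psum B (eone B) (ezero B) = Some (eone B)"
    by (simp_all add: A.psum_ezero A.psum_comm B.psum_ezero B.psum_comm mem)
  \<comment> \<open>The only possible conflict: the same pair of classes is added on both sides.
    Then all summands are 0 or 1, the sum 1 + 1 is undefined, and every other sum gives the same
    class on both sides.\<close>
  have mixed: "?l c = ?r d"
    if "a \<in> carrier A" "a' \<in> carrier A" "psum A a a' = Some c" "b \<in> carrier B" "b' \<in> carrier B"
      "psum B b b' = Some d" "?l a = ?r b" "?l a' = ?r b'" for a a' b b' c d
    using overlap[OF that(1,4,7)] overlap[OF that(2,5,8)] that(3,6) by (auto simp: none sums z)
  have uniq_l: "Z = ?l c" if R: "?R (?l a) (?l a') Z" and a: "a \<in> carrier A" "a' \<in> carrier A"
    and c: "psum A a a' = Some c" for a a' c Z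
    using R unfolding coprod_psum_rel_def
  proof (elim disjE bexE exE conjE)
    fix a1 a1' c1 assume *: "a1 \<in> carrier A" "a1' \<in> carrier A" "?l a = ?l a1" "?l a' = ?l a1'"
      "psum A a1 a1' = Some c1" "Z = ?l c1"
    have "a = a1" "a' = a1'" using inj_onD[OF injl] a * by blast+
    then show ?thesis using * c by simp
  next
    fix b b' d assume "b \<in> carrier B" "b' \<in> carrier B" "?l a = ?r b" "?l a' = ?r b'"
      "psum B b b' = Some d" "Z = ?r d"
    then show ?thesis using mixed[of a a' c b b' d] a c by simp
  qed
  have uniq_r: "Z = ?r d" if R: "?R (?r b) (?r b') Z" and b: "b \<in> carrier B" "b' \<in> carrier B"
    and d: "psum B b b' = Some d" for b b' d Z
    using R unfolding coprod_psum_rel_def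
  proof (elim disjE bexE exE conjE)
    fix b1 b1' d1 assume *: "b1 \<in> carrier B" "b1' \<in> carrier B" "?r b = ?r b1" "?r b' = ?r b1'"
      "psum B b1 b1' = Some d1" "Z = ?r d1"
    have "b = b1" "b' = b1'" using inj_onD[OF injr] b * by blast+
    then show ?thesis using * d by simp
  next
    fix a a' c assume "a \<in> carrier A" "a' \<in> carrier A" "?r b = ?l a" "?r b' = ?l a'"
      "psum A a a' = Some c" "Z = ?l c"
    then show ?thesis using mixed[of a a' c b b' d] b d by simp
  qed
  have uniq: "Z = Z'" if R: "?R X Y Z" and R': "?R X Y Z'" for X Y Z Z'
    using R[unfolded coprod_psum_rel_def]
  proof (elim disjE bexE exE conjE)
    fix a a' c assume "a \<in> carrier A" "a' \<in> carrier A" "X = ?l a" "Y = ?l a'"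
      "psum A a a' = Some c" "Z = ?l c"
    then show ?thesis using uniq_l[of a a' Z' c] R' by simp
  next
    fix b b' d assume "b \<in> carrier B" "b' \<in> carrier B" "X = ?r b" "Y = ?r b'"
      "psum B b b' = Some d" "Z = ?r d"
    then show ?thesis using uniq_r[of b b' Z' d] R' by simp
  qed
  have ps: "psum (coproduct A B) X Y = Some Z \<longleftrightarrow> ?R X Y Z" for X Y Z
  proof (cases "\<exists>Z. ?R X Y Z")
    case True
    then obtain W where W: "?R X Y W" ..
    have "(THE Z. ?R X Y Z) = W" by (rule the_equality, rule W, rule uniq[OF _ W])
    then have "psum (coproduct A B) X Y = Some W" using True by (simp add: coproduct_def)
    then show ?thesis using W uniq[OF _ W, of Z] by auto
  qed (auto simp: coproduct_def)
  have car: "carrier (coproduct A B) = ?l ` carrier A \<union> ?r ` carrier B"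
    by (auto simp: coproduct_def quotient_def coprod_inl_def coprod_inr_def)
  show ?thesis
  proof
    show "psum (coproduct A B) p q = Some s \<Longrightarrow>
      (\<exists>a\<in>carrier A. \<exists>a'\<in>carrier A. \<exists>c. p = ?l a \<and> q = ?l a' \<and> psum A a a' = Some c \<and> s = ?l c) \<or>
      (\<exists>b\<in>carrier B. \<exists>b'\<in>carrier B. \<exists>c. p = ?r b \<and> q = ?r b' \<and> psum B b b' = Some c \<and> s = ?r c)" for p q s
      unfolding ps coprod_psum_rel_def .
    show "psum (coproduct A B) (?l a) (?l b) = Some (?l c)"
      if "a \<in> carrier A" "b \<in> carrier A" "psum A a b = Some c" for a b c
      unfolding ps coprod_psum_rel_def using that by blast
    show "psum (coproduct A B) (?r a) (?r b) = Some (?r c)"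
      if "a \<in> carrier B" "b \<in> carrier B" "psum B a b = Some c" for a b c
      unfolding ps coprod_psum_rel_def using that by blast
    show "?l (ezero A) = ezero (coproduct A B)" "?l (eone A) = eone (coproduct A B)"
      by (simp_all add: coproduct_def)
    show "?r (ezero B) = ezero (coproduct A B)" "?r (eone B) = eone (coproduct A B)"
      by (simp_all add: coproduct_def z)
    show "ezero A \<noteq> eone A" "ezero B \<noteq> eone B" by fact+
  qed (use car injl injr overlap in blast)+
qed

theorem corollary5p2:
  fixes A :: "'a effect_alg" and B :: "'b effect_alg" and n :: nat
  assumes "effect_algebra A" and "ezero A \<noteq> eone A"
    and "effect_algebra B" and "ezero B \<noteq> eone B"
    and "n > 0"
  shows "vs_iso class_ring (HC (coproduct A B) n) (direct_sum (HC A n) (HC B n))"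
  using effect_pushout.HC_pushout[OF coproduct_pushout] assms by blast

end
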